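(* Let $E$ be an elliptic curve over $\mathbb{Q}_2$ with $j$-invariant $j$ satisfying $v_2(j)<0$, and put $L=\mathbb{Q}_2(E[2])$. Then $L$ is one of the following fields: (i) $L=\mathbb{Q}_2$; (ii) $L=\mathbb{Q}_4$ and $u_{L/\mathbb{Q}_2}=0$; (iii) $L=L_i$ for some $i\in\{1,2,\dots,6\}$ and $u_{L/\mathbb{Q}_2}\in\{2,3\}$.
   Context: $\mathbb{Q}_2(E[2])$ is the field generated over $\mathbb{Q}_2$ by the coordinates of the $2$-torsion points of $E(\overline{\mathbb{Q}}_2)$. $v_2$ is normalized by $v_2(\mathbb{Q}_2^\times)=\mathbb{Z}$. $\mathbb{Q}_4$ is the unramified quadratic extension of $\mathbb{Q}_2$. The ramified quadratic extensions $L_1,\dots,L_6$ of $\mathbb{Q}_2$ are those generated by a root of, respectively, $X^2+2X+2$, $X^2+2X+6$, $X^2+2$, $X^2+10$, $X^2+4X+2$, $X^2+4X+10$. Maximal upper ramification break $u_{L/K}$: for a finite extension $L/K$ of finite extensions of $\mathbb{Q}_p$, let $\Gamma(L/K)=\mathrm{Hom}_K(L,\overline{K})$, let $v_L$ be the valuation on $\overline{K}$ with $v_L(L^\times)=\mathbb{Z}$, put $\mathbf{i}_{L/K}(\sigma)=\inf_{a\in\mathcal{O}_L}v_L(\sigma(a)-a)$, and for real $m\geq -1$ put $\Gamma(L/K)_m=\{\sigma\in\Gamma(L/K):\mathbf{i}_{L/K}(\sigma)\geq m+1\}$. Let $\varphi_{L/K}(m)=\frac{1}{e_{L/K}}\int_0^m\#\Gamma(L/K)_y\,dy$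 for $m>0$ (with $e_{L/K}$ the ramification index) and $\varphi_{L/K}(m)=m$ for $-1\le m\le 0$; let $\psi_{L/K}$ be its inverse. Put $\Gamma(L/K)^m=\Gamma(L/K)_{\psi_{L/K}(m)}$ and $\Gamma(L/K)^{(m)}=\Gamma(L/K)^{m-1}$ for $m\geq 0$ (shift by one from Serre's numbering). Then $u_{L/K}=\sup\{m\in\mathbb{R}_{\geq 0}:\Gamma(L/K)^{(m)}\neq 1\}$, with $u_{K/K}=0$. *)

theory Defs
  imports "HOL-Analysis.Analysis" "HOL-Algebra.Generated_Fields" "HOL-Algebra.Embedded_Algebras"
    "HOL-Algebra.Algebraic_Closure_Type"
begin

subsection \<open>The field of 2-adic numbers\<close>

text \<open>The 2-adic integers are the inverse limit of the rings $\mathbf{Z}/2^n$, each residue class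
  being represented by its element in $\{0, \dots, 2^n - 1\}$.\<close>

typedef two_adic_int =
  "{f :: nat \<Rightarrow> int. \<forall>n. f n \<in> {0..<2 ^ n} \<and> f (Suc n) mod 2 ^ n = f n}"
  by (rule exI[of _ "\<lambda>_. 0"]) auto

setup_lifting type_definition_two_adic_int

lemma Rep_two_adic_int_mod: "Rep_two_adic_int x n mod 2 ^ n = Rep_two_adic_int x n"
  using Rep_two_adic_int[of x] by auto

lemma mod_mod_pow2_Suc: "(a :: int) mod 2 ^ Suc n mod 2 ^ n = a mod 2 ^ n"
  by (rule mod_mod_cancel) simp

lemma pow2_coherent_add:
  assumes "f (Suc n) mod 2 ^ n = f n" "g (Suc n) mod 2 ^ n = g n"
  shows "((f (Suc n) + g (Suc n)) mod 2 ^ Suc n) mod 2 ^ n = (f n + g n :: int) mod 2 ^ n"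
  unfolding mod_mod_pow2_Suc by (metis assms mod_add_eq)

lemma pow2_coherent_diff:
  assumes "f (Suc n) mod 2 ^ n = f n" "g (Suc n) mod 2 ^ n = g n"
  shows "((f (Suc n) - g (Suc n)) mod 2 ^ Suc n) mod 2 ^ n = (f n - g n :: int) mod 2 ^ n"
  unfolding mod_mod_pow2_Suc by (metis assms mod_diff_eq)

lemma pow2_coherent_mult:
  assumes "f (Suc n) mod 2 ^ n = f n" "g (Suc n) mod 2 ^ n = g n"
  shows "((f (Suc n) * g (Suc n)) mod 2 ^ Suc n) mod 2 ^ n = (f n * g n :: int) mod 2 ^ n"
  unfolding mod_mod_pow2_Suc by (metis assms mod_mult_eq)

lemma pow2_coherent_minus:
  assumes "f (Suc n) mod 2 ^ n = f n"
  shows "((- f (Suc n)) mod 2 ^ Suc n) mod 2 ^ n = (- f n :: int) mod 2 ^ n"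
  unfolding mod_mod_pow2_Suc by (metis assms mod_minus_eq)

instantiation two_adic_int :: comm_ring_1
begin

lift_definition zero_two_adic_int :: two_adic_int is "\<lambda>_. 0" by simp

lift_definition one_two_adic_int :: two_adic_int is "\<lambda>n. 1 mod 2 ^ n"
  using mod_mod_pow2_Suc by auto

lift_definition plus_two_adic_int :: "two_adic_int \<Rightarrow> two_adic_int \<Rightarrow> two_adic_int"
  is "\<lambda>f g n. (f n + g n) mod 2 ^ n"
  using pow2_coherent_add by simp

lift_definition minus_two_adic_int :: "two_adic_int \<Rightarrow> two_adic_int \<Rightarrow> two_adic_int"
  is "\<lambda>f g n. (f n - g n) mod 2 ^ n"
  using pow2_coherent_diff by simp

lift_definition uminus_two_adic_int :: "two_adic_int \<Rightarrow> two_adic_int"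
  is "\<lambda>f n. (- f n) mod 2 ^ n"
  using pow2_coherent_minus by simp

lift_definition times_two_adic_int :: "two_adic_int \<Rightarrow> two_adic_int \<Rightarrow> two_adic_int"
  is "\<lambda>f g n. (f n * g n) mod 2 ^ n"
  using pow2_coherent_mult by simp

instance
proof
  fix a b c :: two_adic_int
  show "a + b + c = a + (b + c)"
    by transfer (auto simp: mod_simps algebra_simps)
  show "a + b = b + a"
    by transfer (auto simp: algebra_simps)
  show "0 + a = a"
    by transfer auto
  show "- a + a = 0"
    by transfer (auto simp: mod_simps)
  show "a - b = a + - b"
    by transfer (auto simp: mod_simps)
  show "a * b * c = a * (b * c)"
    by transfer (auto simp: mod_simps algebra_simps)
  show "a * b = b * a"
    by transfer (auto simp: algebra_simps)
  show "1 * a = a"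
    by transfer (auto simp: mod_mult_left_eq simp del: one_mod_2_pow_eq)
  show "(a + b) * c = a * c + b * c"
    by transfer (auto simp: mod_simps algebra_simps)
  show "(0 :: two_adic_int) \<noteq> 1"
  proof transfer
    have "(\<lambda>_ :: nat. 0 :: int) 1 \<noteq> (\<lambda>n. 1 mod 2 ^ n) (1 :: nat)" by simp
    thus "(\<lambda>_ :: nat. 0 :: int) \<noteq> (\<lambda>n. 1 mod 2 ^ n)" by metis
  qed
qed

end

lemma two_adic_int_coherent:
  "m \<le> n \<Longrightarrow> Rep_two_adic_int x n mod 2 ^ m = Rep_two_adic_int x m"
proof (induction n rule: dec_induct)
  case base
  show ?case by (rule Rep_two_adic_int_mod)
next
  case (step n)
  have "Rep_two_adic_int x (Suc n) mod 2 ^ m = Rep_two_adic_int x (Suc n) mod 2 ^ n mod 2 ^ m"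
    using step by (metis le_imp_power_dvd mod_mod_cancel)
  also have "Rep_two_adic_int x (Suc n) mod 2 ^ n = Rep_two_adic_int x n"
    using Rep_two_adic_int[of x] by auto
  finally show ?case using step by simp
qed

lemma pow2_not_dvd_mult:
  fixes a b :: int
  assumes "\<not> 2 ^ m dvd a" "\<not> 2 ^ n dvd b"
  shows "\<not> 2 ^ (m + n) dvd a * b"
proof -
  have nz: "a \<noteq> 0" "b \<noteq> 0" using assms by auto
  have "multiplicity 2 a < m" "multiplicity 2 b < n"
    using assms nz by (auto simp: power_dvd_iff_le_multiplicity not_le)
  moreover have "multiplicity 2 (a * b) = multiplicity 2 a + multiplicity 2 b"
    using nz by (intro prime_elem_multiplicity_mult_distrib) auto
  ultimately show ?thesis
    using nz by (simp add: power_dvd_iff_le_multiplicity)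
qed

instance two_adic_int :: idom
proof
  fix a b :: two_adic_int
  have *: "\<exists>n. Rep_two_adic_int x n \<noteq> 0" if "x \<noteq> 0" for x
    using that by transfer auto
  assume "a \<noteq> 0" "b \<noteq> 0"
  then obtain m n where mn: "Rep_two_adic_int a m \<noteq> 0" "Rep_two_adic_int b n \<noteq> 0"
    using * by blast
  have "\<not> 2 ^ m dvd Rep_two_adic_int a (m + n)" "\<not> 2 ^ n dvd Rep_two_adic_int b (m + n)"
    using mn by (metis two_adic_int_coherent dvd_imp_mod_0 le_add1 le_add2)+
  hence "\<not> 2 ^ (m + n) dvd Rep_two_adic_int a (m + n) * Rep_two_adic_int b (m + n)"
    by (rule pow2_not_dvd_mult)
  hence "Rep_two_adic_int (a * b) (m + n) \<noteq> 0"
    by (simp add: times_two_adic_int.rep_eq dvd_eq_mod_eq_0)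
  thus "a * b \<noteq> 0"
    by (metis zero_two_adic_int.rep_eq)
qed

type_synonym two_adic = "two_adic_int fract"

definition v2 :: "two_adic \<Rightarrow> ereal" where
  "v2 x = (if x = 0 then \<infinity>
           else ereal (of_int (THE k. \<exists>u. u dvd 1 \<and> x = 2 powi k * Fract u 1)))"


subsection \<open>Subfields of the algebraic closure\<close>

type_synonym two_adic_closure = "two_adic alg_closure"

abbreviation closure_ring :: "two_adic_closure ring" where
  "closure_ring \<equiv> ring_of_type_algebra"

definition Q2 :: "two_adic_closure set" where
  "Q2 = range to_ac"

definition adjoin_Q2 :: "two_adic_closure set \<Rightarrow> two_adic_closure set" where
  "adjoin_Q2 S = generate_field closure_ring (Q2 \<union> S)"


subsection \<open>Valuations on the algebraic closure\<close>

definition is_valuation :: "('a :: field \<Rightarrow> ereal) \<Rightarrow> bool" where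
  "is_valuation v \<longleftrightarrow>
     (\<forall>x. v x = \<infinity> \<longleftrightarrow> x = 0) \<and> (\<forall>x. v x \<noteq> -\<infinity>) \<and>
     (\<forall>x y. v (x * y) = v x + v y) \<and> (\<forall>x y. v (x + y) \<ge> min (v x) (v y))"

text \<open>The valuation $v_L$ on the algebraic closure with $v_L(L^\times) = \mathbf{Z}$, for
  $L$ a finite extension of $\mathbf{Q}_2$. Since $\mathbf{Q}_2$ is complete, \<^term>\<open>v2\<close> has only
  one extension to its algebraic closure up to scaling, so the choice operator picks the only
  candidate.\<close>

definition normalized_valuation ::
  "two_adic_closure set \<Rightarrow> (two_adic_closure \<Rightarrow> ereal) \<Rightarrow> bool" where
  "normalized_valuation L v \<longleftrightarrow>
     is_valuation v \<and> (\<exists>c::real. c > 0 \<and> (\<forall>x. v (to_ac x) = ereal c * v2 x)) \<and>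
     v ` (L - {0}) = range (\<lambda>k::int. ereal (of_int k))"

definition val :: "two_adic_closure set \<Rightarrow> two_adic_closure \<Rightarrow> ereal" where
  "val L = (SOME v. normalized_valuation L v)"

definition integers_of :: "two_adic_closure set \<Rightarrow> two_adic_closure set" where
  "integers_of L = {a \<in> L. val L a \<ge> 0}"

definition ramification_index :: "two_adic_closure set \<Rightarrow> two_adic_closure set \<Rightarrow> nat" where
  "ramification_index L K =
     (THE e. val L ` (K - {0}) = range (\<lambda>k::int. ereal (of_int (int e * k))))"


subsection \<open>Upper ramification breaks\<close>

text \<open>In all of the following, the first argument is the extension $L$ and the second one is the
  base field $K$.\<close>

definition embeddings ::
  "two_adic_closure set \<Rightarrow> two_adic_closure set \<Rightarrow> (two_adic_closure \<Rightarrow> two_adic_closure) set" where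
  "embeddings L K =
     {\<sigma> \<in> ring_hom (closure_ring\<lparr>carrier := L\<rparr>) closure_ring \<inter> extensional L. \<forall>x\<in>K. \<sigma> x = x}"

definition ram_number ::
  "two_adic_closure set \<Rightarrow> (two_adic_closure \<Rightarrow> two_adic_closure) \<Rightarrow> ereal" where
  "ram_number L \<sigma> = (INF a\<in>integers_of L. val L (\<sigma> a - a))"

definition lower_ram ::
  "two_adic_closure set \<Rightarrow> two_adic_closure set \<Rightarrow> real \<Rightarrow>
   (two_adic_closure \<Rightarrow> two_adic_closure) set" where
  "lower_ram L K m = {\<sigma> \<in> embeddings L K. ram_number L \<sigma> \<ge> ereal (m + 1)}"

definition herbrand_phi :: "two_adic_closure set \<Rightarrow> two_adic_closure set \<Rightarrow> real \<Rightarrow> real" where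
  "herbrand_phi L K m =
     (if m > 0
      then 1 / real (ramification_index L K) *
           integral {0..m} (\<lambda>y. real (card (lower_ram L K y)))
      else m)"

definition herbrand_psi :: "two_adic_closure set \<Rightarrow> two_adic_closure set \<Rightarrow> real \<Rightarrow> real" where
  "herbrand_psi L K = the_inv_into {-1..} (herbrand_phi L K)"

definition upper_ram ::
  "two_adic_closure set \<Rightarrow> two_adic_closure set \<Rightarrow> real \<Rightarrow>
   (two_adic_closure \<Rightarrow> two_adic_closure) set" where
  "upper_ram L K m = lower_ram L K (herbrand_psi L K m)"

definition shifted_upper_ram ::
  "two_adic_closure set \<Rightarrow> two_adic_closure set \<Rightarrow> real \<Rightarrow>
   (two_adic_closure \<Rightarrow> two_adic_closure) set" where
  "shifted_upper_ram L K m = upper_ram L K (m - 1)"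

text \<open>The trivial group of embeddings consists of the inclusion of $L$, which is
  \<^term>\<open>restrict id L\<close> because embeddings are extensional functions. For $L = K$ the supremum
  would range over the empty set.\<close>

definition max_upper_break :: "two_adic_closure set \<Rightarrow> two_adic_closure set \<Rightarrow> real" where
  "max_upper_break L K =
     (if L = K then 0
      else Sup {m. m \<ge> 0 \<and> shifted_upper_ram L K m \<noteq> {restrict id L}})"


subsection \<open>Quadratic extensions\<close>

definition Q4 :: "two_adic_closure set" where
  "Q4 = (THE F. subfield F closure_ring \<and> Q2 \<subseteq> F \<and> ring.dimension closure_ring 2 Q2 F \<and>
            ramification_index F Q2 = 1)"

definition ramified_poly :: "nat \<Rightarrow> two_adic poly" where
  "ramified_poly i =
     [[:2, 2, 1:], [:6, 2, 1:], [:2, 0, 1:], [:10, 0, 1:], [:2, 4, 1:], [:10, 4, 1:]] ! (i - 1)"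

text \<open>Both roots of a quadratic polynomial generate the same field, so the choice of the root does
  not matter.\<close>

definition ramified_quadratic :: "nat \<Rightarrow> two_adic_closure set" where
  "ramified_quadratic i = adjoin_Q2 {SOME x. poly (map_poly to_ac (ramified_poly i)) x = 0}"


subsection \<open>Elliptic curves\<close>

text \<open>Weierstrass equations $y^2 + a_1 xy + a_3 y = x^3 + a_2 x^2 + a_4 x + a_6$.\<close>

datatype 'a weierstrass =
  Weierstrass (a\<^sub>1: 'a) (a\<^sub>2: 'a) (a\<^sub>3: 'a) (a\<^sub>4: 'a) (a\<^sub>6: 'a)

context
  fixes E :: "'a :: field weierstrass"
begin

definition b\<^sub>2 :: 'a where "b\<^sub>2 = a\<^sub>1 E ^ 2 + 4 * a\<^sub>2 E"
definition b\<^sub>4 :: 'a where "b\<^sub>4 = 2 * a\<^sub>4 E + a\<^sub>1 E * a\<^sub>3 E"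
definition b\<^sub>6 :: 'a where "b\<^sub>6 = a\<^sub>3 E ^ 2 + 4 * a\<^sub>6 E"
definition b\<^sub>8 :: 'a where
  "b\<^sub>8 = a\<^sub>1 E ^ 2 * a\<^sub>6 E + 4 * a\<^sub>2 E * a\<^sub>6 E - a\<^sub>1 E * a\<^sub>3 E * a\<^sub>4 E + a\<^sub>2 E * a\<^sub>3 E ^ 2 - a\<^sub>4 E ^ 2"
definition c\<^sub>4 :: 'a where "c\<^sub>4 = b\<^sub>2 ^ 2 - 24 * b\<^sub>4"
definition discriminant :: 'a where
  "discriminant = - (b\<^sub>2 ^ 2 * b\<^sub>8) - 8 * b\<^sub>4 ^ 3 - 27 * b\<^sub>6 ^ 2 + 9 * b\<^sub>2 * b\<^sub>4 * b\<^sub>6"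
definition elliptic_curve :: bool where "elliptic_curve \<longleftrightarrow> discriminant \<noteq> 0"
definition j_invariant :: 'a where "j_invariant = c\<^sub>4 ^ 3 / discriminant"

end

datatype 'a ec_point = Infinity | Affine 'a 'a

definition ec_points :: "'a :: field weierstrass \<Rightarrow> 'a ec_point set" where
  "ec_points E = insert Infinity
     {Affine x y | x y. y ^ 2 + a\<^sub>1 E * x * y + a\<^sub>3 E * y = x ^ 3 + a\<^sub>2 E * x ^ 2 + a\<^sub>4 E * x + a\<^sub>6 E}"

text \<open>The chord-tangent law: the line through (or the tangent at) the two points is
  $y = \lambda x + \nu$, and the first case is that of opposite points.\<close>

fun ec_add :: "'a :: field weierstrass \<Rightarrow> 'a ec_point \<Rightarrow> 'a ec_point \<Rightarrow> 'a ec_point" where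
  "ec_add E Infinity P = P"
| "ec_add E P Infinity = P"
| "ec_add E (Affine x1 y1) (Affine x2 y2) =
     (if x1 = x2 \<and> y1 + y2 + a\<^sub>1 E * x2 + a\<^sub>3 E = 0 then Infinity
      else
        let d = (if x1 = x2 then 2 * y1 + a\<^sub>1 E * x1 + a\<^sub>3 E else x2 - x1);
            l = (if x1 = x2 then 3 * x1 ^ 2 + 2 * a\<^sub>2 E * x1 + a\<^sub>4 E - a\<^sub>1 E * y1 else y2 - y1) / d;
            n = y1 - l * x1;
            x3 = l ^ 2 + a\<^sub>1 E * l - a\<^sub>2 E - x1 - x2
        in Affine x3 (- (l + a\<^sub>1 E) * x3 - n - a\<^sub>3 E))"

definition ec_torsion :: "'a :: field weierstrass \<Rightarrow> nat \<Rightarrow> 'a ec_point set" where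
  "ec_torsion E n = {P \<in> ec_points E. (ec_add E P ^^ n) Infinity = Infinity}"

definition torsion_field :: "two_adic weierstrass \<Rightarrow> nat \<Rightarrow> two_adic_closure set" where
  "torsion_field E n =
     adjoin_Q2 (\<Union>P\<in>ec_torsion (map_weierstrass to_ac E) n. set_ec_point P)"

end

theory Submission
  imports Defs
begin

text \<open>If \<open>v\<^sub>2(j) < 0\<close>, the 2-division polynomial of \<open>E\<close> has a root in the 2-adic numbers, because after
  rescaling it is 2-adically close to \<open>(Z - 6) (Z + 3)\<^sup>2\<close>. Hence \<open>L\<close> is generated by a square root, and
  the square classes of 2-adic numbers leave eight possibilities for \<open>L\<close>.

  The valuation \<open>v\<^sub>2\<close> extends to the algebraic closure since a maximal subring containing the 2-adic
  integers but not \<open>1/2\<close> is a valuation ring of rank one. In an Eisenstein extension \<open>v(\<theta>)\<close> is forced to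
  be half of \<open>v(2)\<close>, so the integers are spanned by \<open>1, \<theta>\<close>, and the ramification number of the
  conjugation is the valuation of the square root of the discriminant; this number is also the
  maximal upper break in the shifted numbering.\<close>

hide_const (open) up_ring.coeff up_ring.monom Polynomials.degree module.smult

section \<open>The ring of 2-adic integers\<close>

text \<open>Behind the cubic stands the Tate curve: \<open>E\<close> is a quadratic twist of one
  with some parameter q, and its nonzero 2-torsion consists of the rational point -1 and of the two
  square roots of q. Two choices in the definitions shape the rest. The valuation
  \<open>val L\<close> is picked by a choice operator, so nothing can be said about it before some
  extension of \<open>v2\<close> to the whole closure has been constructed; this is what the detour
  through maximal subrings provides. And \<open>Q4\<close> is a definite description of the
  quadratic field of ramification index 1, so identifying it requires a classification of all
  quadratic fields together with the ramification indices of the six Eisenstein ones, not merely of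
  the fields that arise as \<open>L\<close>.\<close>

lemma Rep_of_nat: "Rep_two_adic_int (of_nat k) n = int k mod 2 ^ n"
  by (induction k)
    (auto simp: zero_two_adic_int.rep_eq plus_two_adic_int.rep_eq one_two_adic_int.rep_eq mod_simps
      simp del: one_mod_2_pow_eq)

lemma Rep_two_power: "Rep_two_adic_int (2 ^ k) n = 2 ^ k mod 2 ^ n"
  using Rep_of_nat[of "2 ^ k" n] by simp

lemma Rep_diff_eq_0_iff:
  "Rep_two_adic_int (x - y) n = 0 \<longleftrightarrow> Rep_two_adic_int x n = Rep_two_adic_int y n"
proof -
  have "Rep_two_adic_int (x - y) n = 0 \<longleftrightarrow>
      Rep_two_adic_int x n mod 2 ^ n = Rep_two_adic_int y n mod 2 ^ n"
    by (simp add: minus_two_adic_int.rep_eq mod_eq_dvd_iff dvd_eq_mod_eq_0)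
  thus ?thesis by (simp add: Rep_two_adic_int_mod)
qed

text \<open>Dividing by 2^n drops the n lowest binary digits, which vanish here. The quotient modulo
  2^m therefore has to be read off from x modulo 2^(m + n).\<close>

lemma two_power_dvd_iff: "2 ^ n dvd x \<longleftrightarrow> Rep_two_adic_int x n = 0"
proof
  assume "2 ^ n dvd x"
  then obtain y where "x = 2 ^ n * y" by (elim dvdE)
  thus "Rep_two_adic_int x n = 0"
    by (simp add: times_two_adic_int.rep_eq Rep_two_power)
next
  assume *: "Rep_two_adic_int x n = 0"
  define f where "f = (\<lambda>m. Rep_two_adic_int x (m + n) div 2 ^ n)"
  have dvd: "2 ^ n dvd Rep_two_adic_int x (m + n)" for m
    using two_adic_int_coherent[of n "m + n" x] * by (simp add: dvd_eq_mod_eq_0)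
  have coh: "f (Suc m) mod 2 ^ m = f m" for m
  proof -
    have "Rep_two_adic_int x (m + n) = Rep_two_adic_int x (Suc m + n) mod 2 ^ (m + n)"
      using two_adic_int_coherent[of "m + n" "Suc m + n" x] by simp
    moreover have "a mod 2 ^ (m + n) div 2 ^ n = a div 2 ^ n mod 2 ^ m" for a :: int
      by (metis drop_bit_eq_div drop_bit_take_bit take_bit_eq_mod add_diff_cancel_right')
    ultimately show ?thesis
      by (simp add: f_def)
  qed
  have "f m mod 2 ^ m = f m" for m
    using coh[of m] by (metis mod_mod_trivial)
  hence "f m \<in> {0..<2 ^ m}" for m
    by (metis atLeastLessThan_iff pos_mod_bound pos_mod_sign zero_less_numeral zero_less_power)
  then obtain y where y: "Rep_two_adic_int y = f"
    using coh Abs_two_adic_int_inverse[of f] by auto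
  have "Rep_two_adic_int (2 ^ n * y) m = Rep_two_adic_int x m" for m
  proof -
    have "Rep_two_adic_int (2 ^ n * y) m = (2 ^ n * f m) mod 2 ^ m"
      by (simp add: times_two_adic_int.rep_eq Rep_two_power y mod_simps)
    also have "\<dots> = Rep_two_adic_int x (m + n) mod 2 ^ m"
      using dvd by (simp add: f_def)
    finally show ?thesis using two_adic_int_coherent[of m "m + n" x] by simp
  qed
  hence "2 ^ n * y = x" by (metis Rep_two_adic_int_inject ext)
  thus "2 ^ n dvd x" by auto
qed

lemma two_power_dvd_all_imp_0: "(\<And>n. 2 ^ n dvd (x :: two_adic_int)) \<Longrightarrow> x = 0"
  unfolding two_power_dvd_iff by (metis Rep_two_adic_int_inject ext zero_two_adic_int.rep_eq)

section \<open>Completeness, units and fixed-point equations\<close>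

text \<open>The n-th term already determines the limit modulo 2^n, so the diagonal of residues is a
  coherent sequence and is itself the limit.\<close>

lemma two_adic_int_complete:
  fixes y :: "nat \<Rightarrow> two_adic_int"
  assumes "\<And>n. 2 ^ n dvd y (Suc n) - y n"
  obtains l where "\<And>n. 2 ^ n dvd l - y n"
proof -
  define f where "f = (\<lambda>n. Rep_two_adic_int (y n) n)"
  have "f n \<in> {0..<2 ^ n}" for n
    using Rep_two_adic_int[of "y n"] by (simp add: f_def)
  moreover have "f (Suc n) mod 2 ^ n = f n" for n
    using assms[of n] two_adic_int_coherent[of n "Suc n" "y (Suc n)"]
    by (simp add: f_def two_power_dvd_iff Rep_diff_eq_0_iff)
  ultimately obtain l where "Rep_two_adic_int l = f"
    using Abs_two_adic_int_inverse[of f] by auto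
  hence "2 ^ n dvd l - y n" for n
    by (simp add: two_power_dvd_iff Rep_diff_eq_0_iff f_def)
  thus ?thesis by (rule that)
qed

text \<open>Banach's fixed-point theorem, taking the place of Hensel's lemma: every equation to be
  solved is first rewritten as y = g y with a map g that gains a factor 2.\<close>

lemma two_adic_int_contraction_fixpoint:
  fixes g :: "two_adic_int \<Rightarrow> two_adic_int"
  assumes contr: "\<And>n y z. 2 ^ n dvd y - z \<Longrightarrow> 2 ^ Suc n dvd g y - g z"
  obtains y where "g y = y"
proof -
  have "2 ^ n dvd (g ^^ Suc n) 0 - (g ^^ n) 0" for n
    by (induction n) (auto intro: contr simp del: power_Suc)
  then obtain l where l: "\<And>n. 2 ^ n dvd l - (g ^^ n) 0"
    using two_adic_int_complete[of "\<lambda>n. (g ^^ n) 0"] by blast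
  have "2 ^ n dvd g l - l" for n
  proof -
    have "2 ^ n dvd g l - g ((g ^^ n) 0)"
      using contr[OF l[of n]] by (metis dvd_mult_right power_Suc)
    moreover have "2 ^ n dvd l - (g ^^ Suc n) 0"
      using l[of "Suc n"] by (metis dvd_mult_right power_Suc)
    ultimately show ?thesis
      using dvd_diff[of "2 ^ n" "g l - g ((g ^^ n) 0)" "l - (g ^^ Suc n) 0"] by simp
  qed
  hence "g l - l = 0" by (rule two_power_dvd_all_imp_0)
  thus ?thesis using that by simp
qed

lemma two_adic_int_unit_iff: "(x :: two_adic_int) dvd 1 \<longleftrightarrow> \<not> 2 dvd x"
proof
  assume "x dvd 1"
  moreover have "\<not> 2 dvd (1 :: two_adic_int)"
    using two_power_dvd_iff[of 1 1] by (simp add: one_two_adic_int.rep_eq)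
  ultimately show "\<not> 2 dvd x" using dvd_trans by blast
next
  assume "\<not> 2 dvd x"
  hence "Rep_two_adic_int x 1 \<noteq> 0"
    using two_power_dvd_iff[of 1 x] by simp
  moreover have "Rep_two_adic_int x 1 \<in> {0..<2}"
    using Rep_two_adic_int[of x] by (metis (no_types, lifting) mem_Collect_eq power_one_right)
  ultimately have "Rep_two_adic_int x 1 = Rep_two_adic_int 1 1"
    by (auto simp: one_two_adic_int.rep_eq)
  hence "2 dvd x - 1"
    using two_power_dvd_iff[of 1 "x - 1"] by (simp add: Rep_diff_eq_0_iff)
  then obtain a where a: "x - 1 = 2 * a" by (elim dvdE)
  \<comment> \<open>A fixed point of y = 1 - 2 a y satisfies (1 + 2 a) y = 1, so it is the inverse
    of x.\<close>
  have "2 ^ Suc n dvd (1 - 2 * a * y) - (1 - 2 * a * z)" if "2 ^ n dvd y - z" for n y z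
  proof -
    have "(1 - 2 * a * y) - (1 - 2 * a * z) = 2 * (y - z) * (- a)" by (simp add: algebra_simps)
    thus ?thesis using that by (metis dvd_mult2 mult_dvd_mono dvd_refl power_Suc)
  qed
  then obtain y where "1 - 2 * a * y = y"
    using two_adic_int_contraction_fixpoint[of "\<lambda>y. 1 - 2 * a * y"] by blast
  moreover have "x = 1 + 2 * a" using a by (simp add: algebra_simps)
  ultimately have "1 = x * y" by (simp add: algebra_simps)
  thus "x dvd 1" by (metis dvd_triv_left)
qed

lemma two_adic_int_decomp:
  assumes "(x :: two_adic_int) \<noteq> 0"
  obtains k u where "x = 2 ^ k * u" "u dvd 1"
proof -
  obtain n where n: "\<not> 2 ^ n dvd x"
    using two_power_dvd_all_imp_0 assms by blast
  define m where "m = (LEAST n. \<not> 2 ^ n dvd x)"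
  have m: "\<not> 2 ^ m dvd x" unfolding m_def using n by (rule LeastI)
  then obtain k where k: "m = Suc k" by (cases m) auto
  have "2 ^ k dvd x"
    using not_less_Least[of k "\<lambda>n. \<not> 2 ^ n dvd x"] k m_def by auto
  then obtain u where u: "x = 2 ^ k * u" by (elim dvdE)
  have "\<not> 2 dvd u"
    using m k u by (auto simp: mult_dvd_mono mult.commute)
  thus ?thesis using that u two_adic_int_unit_iff by blast
qed

text \<open>Expanding (1 + 4 z)^2 = 1 + 8 a or (1 + 64 z)^2 = 1 + 128 a and dividing by the
  coefficient of z leaves this equation, with c = 1 or c = 16.\<close>

lemma quadratic_fixpoint: "\<exists>z. z = a - 2 * c * z\<^sup>2" for a c :: two_adic_int
proof -
  have "2 ^ Suc n dvd (a - 2 * c * y\<^sup>2) - (a - 2 * c * z\<^sup>2)" if "2 ^ n dvd y - z" for n y z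
  proof -
    have "(a - 2 * c * y\<^sup>2) - (a - 2 * c * z\<^sup>2) = 2 * (y - z) * (- (c * (y + z)))"
      by (simp add: algebra_simps power2_eq_square)
    thus ?thesis using that by (metis dvd_mult2 mult_dvd_mono dvd_refl power_Suc)
  qed
  then obtain z where "a - 2 * c * z\<^sup>2 = z"
    using two_adic_int_contraction_fixpoint[of "\<lambda>z. a - 2 * c * z\<^sup>2"] by blast
  thus ?thesis by metis
qed

lemma square_of_one_mod_8: "\<exists>y. 1 + 8 * a = (y :: two_adic_int)\<^sup>2"
proof -
  obtain z where "z = a - 2 * 1 * z\<^sup>2" using quadratic_fixpoint by blast
  hence "a = z + 2 * z\<^sup>2" by (simp add: algebra_simps)
  hence "1 + 8 * a = (1 + 4 * z)\<^sup>2" by (simp add: algebra_simps power2_eq_square)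
  thus ?thesis ..
qed

text \<open>The congruence of the root to 1 modulo 64 is the point: it measures how close the
  rescaled 2-division cubic is to its degenerate form.\<close>

lemma square_of_one_mod_128: "\<exists>z. 1 + 128 * a = (1 + 64 * z :: two_adic_int)\<^sup>2"
proof -
  obtain z where "z = a - 2 * 16 * z\<^sup>2" using quadratic_fixpoint by blast
  hence "a = z + 32 * z\<^sup>2" by (simp add: algebra_simps)
  hence "1 + 128 * a = (1 + 64 * z)\<^sup>2" by (simp add: algebra_simps power2_eq_square)
  thus ?thesis ..
qed

text \<open>Putting Z = 6 + 2 z in Z^3 - 27 Z - 54 (1 + 64 y) and halving gives 4 z^3 + 36 z^2 + 81
  z - 1728 y. Splitting 81 = 1 + 80 isolates z, and the remaining coefficients are even; a stands
  for -1728 y.\<close>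

lemma cubic_fixpoint:
  "\<exists>z. z = - (a + 80 * z + 36 * z\<^sup>2 + 4 * z ^ 3 :: two_adic_int)"
proof -
  let ?g = "\<lambda>z. - (a + 80 * z + 36 * z\<^sup>2 + 4 * z ^ 3)"
  have "2 ^ Suc n dvd ?g y - ?g z" if "2 ^ n dvd y - z" for n y z
  proof -
    have "?g y - ?g z = 2 * (y - z) * (- (40 + 18 * (y + z) + 2 * (y\<^sup>2 + y * z + z\<^sup>2)))"
      by (simp add: algebra_simps power2_eq_square power3_eq_cube)
    thus ?thesis using that by (metis dvd_mult2 mult_dvd_mono dvd_refl power_Suc)
  qed
  then obtain y where "?g y = y"
    using two_adic_int_contraction_fixpoint[of ?g] by blast
  thus ?thesis by metis
qed

instance two_adic_int :: ring_char_0
proof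
  have "of_nat k \<noteq> (0 :: two_adic_int)" if "k > 0" for k
  proof
    assume "of_nat k = (0 :: two_adic_int)"
    \<comment> \<open>Level k suffices, because 0 < k < 2^k makes k its own residue there.\<close>
    hence "int k mod 2 ^ k = 0"
      using Rep_of_nat[of k k] by (simp add: zero_two_adic_int.rep_eq)
    moreover have "int k < 2 ^ k"
      by (metis of_nat_less_iff of_nat_numeral of_nat_power less_exp)
    ultimately show False using that by simp
  qed
  hence "k = l" if "of_nat k = (of_nat l :: two_adic_int)" for k l
    using that
    by (metis diff_is_0_eq' eq_iff_diff_eq_0 linorder_not_less nat_le_linear of_nat_diff
        zero_less_diff order_antisym_conv)
  thus "inj (of_nat :: nat \<Rightarrow> two_adic_int)" by (rule injI)
qed

instance fract :: ("{idom, ring_char_0}") field_char_0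
proof
  show "inj (of_nat :: nat \<Rightarrow> 'a fract)"
    by (rule injI) (simp add: of_nat_fract eq_fract)
qed

section \<open>The 2-adic numbers\<close>

lemma to_fract_of_nat [simp]: "to_fract (of_nat n) = of_nat n"
  by (induction n) auto

lemma to_fract_numeral [simp]: "to_fract (numeral n) = numeral n"
  by (metis of_nat_numeral to_fract_of_nat)

lemma to_fract_power [simp]: "to_fract (x ^ n) = to_fract x ^ n"
  by (induction n) auto

lemma unit_inverse:
  assumes "(u :: two_adic_int) dvd 1"
  obtains u' where "u' dvd 1" "inverse (to_fract u) = to_fract u'"
proof -
  obtain u' where u': "1 = u * u'" using assms by (elim dvdE)
  hence "to_fract u * to_fract u' = 1" by (metis to_fract_1 to_fract_mult)
  hence "inverse (to_fract u) = to_fract u'" by (rule inverse_unique)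
  moreover have "u' dvd 1" using u' by (metis dvd_triv_right)
  ultimately show ?thesis using that by blast
qed

lemma two_adic_decomp:
  assumes "(x :: two_adic) \<noteq> 0"
  obtains k u where "x = 2 powi k * to_fract u" "u dvd 1"
proof -
  obtain a b where ab: "x = Fract a b" "b \<noteq> 0" by (cases x)
  hence x: "x = to_fract a / to_fract b" by (simp add: Fract_conv_to_fract)
  hence "a \<noteq> 0" using assms by auto
  then obtain k u where ku: "a = 2 ^ k * u" "u dvd 1" by (rule two_adic_int_decomp)
  obtain l w where lw: "b = 2 ^ l * w" "w dvd 1" using ab(2) by (rule two_adic_int_decomp)
  obtain w' where w': "w' dvd 1" "inverse (to_fract w) = to_fract w'"
    using lw(2) by (rule unit_inverse)
  have "x = 2 powi (int k - int l) * to_fract (u * w')"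
    unfolding x ku lw
    by (simp add: power_int_diff divide_inverse w'(2)[symmetric])
  moreover have "u * w' dvd 1" using mult_dvd_mono[OF ku(2) w'(1)] by simp
  ultimately show ?thesis by (rule that)
qed

lemma two_powi_not_integral:
  assumes "k < 0" "u dvd 1"
  shows "2 powi k * to_fract u \<noteq> to_fract (a :: two_adic_int)"
proof
  assume *: "2 powi k * to_fract u = to_fract a"
  obtain n where n: "k = - int (Suc n)"
    using assms(1) by (metis negD)
  have "to_fract u = 2 ^ Suc n * to_fract a"
    using * by (simp add: n power_int_minus field_simps del: power_Suc of_nat_Suc)
  also have "\<dots> = to_fract (2 ^ Suc n * a)" by simp
  finally have "u = 2 * (2 ^ n * a)" by (simp del: to_fract_mult to_fract_power)
  hence "2 dvd u" by simp
  thus False using assms(2) two_adic_int_unit_iff by blast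
qed

lemma two_adic_decomp_unique:
  fixes u u' :: two_adic_int
  assumes "u dvd 1" "u' dvd 1" "2 powi k * to_fract u = 2 powi l * to_fract u'"
  shows "k = l"
proof -
  have "\<not> k < l" if "u dvd 1" "u' dvd 1" and eq: "2 powi k * to_fract u = 2 powi l * to_fract u'"
    for k l and u u' :: two_adic_int
  proof
    assume "k < l"
    have "2 powi (k - l) * to_fract u = (2 powi k * to_fract u) / 2 powi l"
      by (simp add: power_int_diff)
    also have "\<dots> = to_fract u'" unfolding eq by simp
    finally show False using two_powi_not_integral[of "k - l" u u'] \<open>k < l\<close> that(1) by simp
  qed
  thus ?thesis using assms by (metis linorder_neqE)
qed

section \<open>The 2-adic valuation and the square classes\<close>

lemma v2_0 [simp]: "v2 0 = \<infinity>"
  by (simp add: v2_def)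

lemma v2_decomp:
  assumes "u dvd 1"
  shows "v2 (2 powi k * to_fract u) = ereal (of_int k)"
proof -
  have "u \<noteq> 0" using assms by auto
  hence "2 powi k * to_fract u \<noteq> 0" by simp
  moreover have "(THE l. \<exists>u'. u' dvd 1 \<and> 2 powi k * to_fract u = 2 powi l * Fract u' 1) = k"
    using assms two_adic_decomp_unique by (intro the_equality) (auto simp flip: to_fract_def)
  ultimately show ?thesis by (simp add: v2_def)
qed

lemma v2_to_fract_unit: "u dvd 1 \<Longrightarrow> v2 (to_fract u) = 0"
  using v2_decomp[of u 0] by simp

lemma v2_powi_2: "v2 (2 powi k) = ereal (of_int k)"
  using v2_decomp[of 1 k] by simp

lemma v2_2 [simp]: "v2 2 = 1"
  using v2_powi_2[of 1] by (simp add: one_ereal_def)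

lemma v2_eq_int:
  assumes "x \<noteq> 0"
  obtains k :: int where "v2 x = ereal (of_int k)"
  using assms by (metis two_adic_decomp v2_decomp)

lemma v2_mult: "v2 (x * y) = v2 x + v2 y"
proof (cases "x = 0 \<or> y = 0")
  case True
  moreover have "v2 x \<noteq> -\<infinity>" for x by (cases "x = 0") (auto elim: v2_eq_int)
  ultimately show ?thesis by auto
next
  case False
  then obtain k u l w where "x = 2 powi k * to_fract u" "u dvd 1" "y = 2 powi l * to_fract w" "w dvd 1"
    using two_adic_decomp by metis
  moreover from this have "x * y = 2 powi (k + l) * to_fract (u * w)" "u * w dvd 1"
    using mult_dvd_mono[of u 1 w 1] by (auto simp: power_int_add)
  ultimately show ?thesis by (simp only: v2_decomp) simp
qed

lemma v2_1 [simp]: "v2 1 = 0"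
  using v2_to_fract_unit[of 1] by simp

lemma v2_uminus: "v2 (- x) = v2 x"
  using v2_mult[of "-1" x] v2_to_fract_unit[of "-1"] by simp

lemma unit_mod_8:
  assumes "(u :: two_adic_int) dvd 1"
  obtains r a where "r \<in> {1, 3, 5, 7}" "u = r + 8 * a"
proof -
  define k where "k = Rep_two_adic_int u 3"
  have k: "k \<in> {0..<8}" using Rep_two_adic_int[of u] by (auto simp: k_def dest!: spec[of _ 3])
  have "Rep_two_adic_int (of_nat (nat k)) 3 = k"
    unfolding Rep_of_nat using k by simp
  hence "Rep_two_adic_int (u - of_nat (nat k)) 3 = 0"
    unfolding Rep_diff_eq_0_iff by (simp add: k_def)
  hence "2 ^ 3 dvd u - of_nat (nat k)" unfolding two_power_dvd_iff .
  then obtain a where "u - of_nat (nat k) = 8 * a" by (elim dvdE) auto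
  hence a: "u = of_nat (nat k) + 8 * a" by (simp add: algebra_simps)
  have odd: "\<not> 2 dvd u" using assms two_adic_int_unit_iff by blast
  have "\<not> even (nat k)"
  proof
    assume "even (nat k)"
    then obtain m where "nat k = 2 * m" by (elim dvdE)
    hence "u = 2 * (of_nat m + 4 * a)" using a by (simp add: algebra_simps)
    thus False using odd by (metis dvd_triv_left)
  qed
  hence "k = 1 \<or> k = 3 \<or> k = 5 \<or> k = 7" using k by (simp add: even_nat_iff) presburger
  hence "of_nat (nat k) \<in> {1, 3, 5, 7 :: two_adic_int}" by auto
  thus ?thesis using a that by blast
qed

lemma one_plus_8_square: "\<exists>y. to_fract (1 + 8 * a) = (y :: two_adic)\<^sup>2"
  using square_of_one_mod_8[of a] by (metis to_fract_power)

text \<open>The representatives are chosen to fit the fields: -3 is the discriminant of X^2 + X + 1,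
  and the last six are, in order, a quarter of the discriminants of the six Eisenstein
  polynomials.\<close>

lemma square_class:
  assumes "(d :: two_adic) \<noteq> 0"
  obtains e c where "e \<in> {1, -3, -1, -5, -2, -10, 2, -6}" "c \<noteq> 0" "d = e * c\<^sup>2"
proof -
  obtain k u where d: "d = 2 powi k * to_fract u" "u dvd 1" using assms by (rule two_adic_decomp)
  obtain r a where r: "r \<in> {1, 3, 5, 7}" "u = r + 8 * a" using d(2) by (rule unit_mod_8)
  \<comment> \<open>The numbers -5, -3, -1 are congruent to 3, 5, 7 modulo 8, and they as well as
    their doubles occur in the list.\<close>
  define s :: "two_adic_int" where "s = (if r = 1 then 1 else if r = 3 then -5 else if r = 5 then -3 else -1)"
  have s: "s \<in> {1, -3, -1, -5}" by (simp add: s_def)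
  \<comment> \<open>Units that agree modulo 8 differ by a factor congruent to 1 modulo 8, and such a
    factor is a square.\<close>
  have "\<exists>b. u = s * (1 + 8 * b)"
  proof -
    have "s dvd 1"
    proof -
      have "s = 1 + 2 * 0 \<or> s = 1 + 2 * (-2) \<or> s = 1 + 2 * (- 1) \<or> s = 1 + 2 * (-3)" using s by auto
      hence "\<not> 2 dvd s"
        by (metis dvd_add_times_triv_right_iff mult.commute two_adic_int_unit_iff dvd_refl)
      thus ?thesis by (simp add: two_adic_int_unit_iff)
    qed
    then obtain s' where s': "1 = s * s'" by (elim dvdE)
    have "\<exists>c. r = s + 8 * c"
      using r(1) unfolding s_def
      by (auto intro: exI[of _ 0] exI[of _ 1])
    then obtain c where "r = s + 8 * c" ..
    hence "u = s + 8 * (a + c) * (s * s')" using r(2) s' by (simp add: algebra_simps)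
    hence "u = s * (1 + 8 * ((a + c) * s'))" by (simp add: algebra_simps)
    thus ?thesis ..
  qed
  then obtain b where b: "u = s * (1 + 8 * b)" ..
  obtain y where y: "to_fract (1 + 8 * b) = y\<^sup>2" using one_plus_8_square by blast
  have "u \<noteq> 0" using d(2) by auto
  hence "y \<noteq> 0" using b y by (metis mult_zero_right to_fract_eq_0_iff zero_power2)
  define m where "m = k div 2"
  have "d = (if even k then 1 else 2) * to_fract s * (2 powi m * y)\<^sup>2"
  proof -
    have "(2 :: two_adic) powi k = (2 powi m)\<^sup>2 * (if even k then 1 else 2)"
    proof (cases "even k")
      case True
      hence k: "k = m + m" by (simp add: m_def)
      show ?thesis using True unfolding k by (subst power_int_add) (simp_all add: power2_eq_square)
    next
      case False
      hence k: "k = m + m + 1" by (auto simp: m_def elim!: oddE)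
      have "(2 :: two_adic) powi (m + m + 1) = 2 powi m * 2 powi m * 2"
        by (simp only: power_int_add zero_neq_numeral[symmetric] power_int_1_right simp_thms not_False_eq_True)
      thus ?thesis using False unfolding k by (simp add: power2_eq_square)
    qed
    thus ?thesis unfolding d(1) b to_fract_mult y by (simp add: power_mult_distrib)
  qed
  moreover have "(if even k then 1 else 2) * to_fract s \<in> {1, -3, -1, -5, -2, -10, 2, -6 :: two_adic}"
    using s by auto
  moreover have "2 powi m * y \<noteq> 0" using \<open>y \<noteq> 0\<close> by simp
  ultimately show ?thesis using that by blast
qed

section \<open>Extending the valuation to the algebraic closure\<close>

definition coeffs_in :: "'a :: zero set \<Rightarrow> 'a poly \<Rightarrow> bool" where
  "coeffs_in R p \<longleftrightarrow> (\<forall>i. coeff p i \<in> R)"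

locale subring_of_field =
  fixes R :: "'a :: field set"
  assumes one_mem: "1 \<in> R"
    and add_mem: "x \<in> R \<Longrightarrow> y \<in> R \<Longrightarrow> x + y \<in> R"
    and minus_mem: "x \<in> R \<Longrightarrow> - x \<in> R"
    and mult_mem: "x \<in> R \<Longrightarrow> y \<in> R \<Longrightarrow> x * y \<in> R"
begin

lemma zero_mem: "0 \<in> R"
  using add_mem[OF one_mem minus_mem[OF one_mem]] by simp

lemma diff_mem: "x \<in> R \<Longrightarrow> y \<in> R \<Longrightarrow> x - y \<in> R"
  using add_mem[of x "- y"] minus_mem[of y] by simp

lemma power_mem: "x \<in> R \<Longrightarrow> x ^ n \<in> R"
  by (induction n) (auto intro: one_mem mult_mem)

lemma sum_mem: "(\<And>i. i \<in> A \<Longrightarrow> f i \<in> R) \<Longrightarrow> sum f A \<in> R"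
  by (induction A rule: infinite_finite_induct) (auto intro: zero_mem add_mem)

lemma coeffs_in_add: "coeffs_in R p \<Longrightarrow> coeffs_in R q \<Longrightarrow> coeffs_in R (p + q)"
  by (simp add: coeffs_in_def add_mem)

lemma coeffs_in_diff: "coeffs_in R p \<Longrightarrow> coeffs_in R q \<Longrightarrow> coeffs_in R (p - q)"
  by (simp add: coeffs_in_def diff_mem)

lemma coeffs_in_minus: "coeffs_in R p \<Longrightarrow> coeffs_in R (- p)"
  by (simp add: coeffs_in_def minus_mem)

lemma coeffs_in_mult: "coeffs_in R p \<Longrightarrow> coeffs_in R q \<Longrightarrow> coeffs_in R (p * q)"
  by (simp add: coeffs_in_def coeff_mult mult_mem sum_mem)

lemma coeffs_in_smult: "c \<in> R \<Longrightarrow> coeffs_in R p \<Longrightarrow> coeffs_in R (smult c p)"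
  by (simp add: coeffs_in_def mult_mem)

lemma coeffs_in_monom: "c \<in> R \<Longrightarrow> coeffs_in R (monom c n)"
  by (simp add: coeffs_in_def zero_mem)

lemma coeffs_in_sum: "(\<And>i. i \<in> A \<Longrightarrow> coeffs_in R (f i)) \<Longrightarrow> coeffs_in R (sum f A)"
  by (simp add: coeffs_in_def coeff_sum sum_mem)

definition adjoin :: "'a \<Rightarrow> 'a set" where
  "adjoin x = {poly p x | p. coeffs_in R p}"

lemma adjoin_subring: "subring_of_field (adjoin x)"
proof
  show "1 \<in> adjoin x"
    unfolding adjoin_def using coeffs_in_monom[OF one_mem, of 0]
    by (intro CollectI exI[of _ "monom 1 0"]) (simp add: poly_monom)
next
  fix y z assume "y \<in> adjoin x" "z \<in> adjoin x"
  then obtain p q where pq: "y = poly p x" "z = poly q x" "coeffs_in R p" "coeffs_in R q"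
    by (auto simp: adjoin_def)
  show "y + z \<in> adjoin x"
    unfolding adjoin_def using pq coeffs_in_add by (intro CollectI exI[of _ "p + q"]) simp
  show "y * z \<in> adjoin x"
    unfolding adjoin_def using pq coeffs_in_mult by (intro CollectI exI[of _ "p * q"]) simp
next
  fix y assume "y \<in> adjoin x"
  then obtain p where "y = poly p x" "coeffs_in R p" by (auto simp: adjoin_def)
  thus "- y \<in> adjoin x"
    unfolding adjoin_def using coeffs_in_minus by (intro CollectI exI[of _ "- p"]) simp
qed

lemma adjoin_incl: "R \<subseteq> adjoin x"
proof
  fix y assume "y \<in> R"
  thus "y \<in> adjoin x"
    unfolding adjoin_def using coeffs_in_monom[of y 0]
    by (intro CollectI exI[of _ "monom y 0"]) (simp add: poly_monom)
qed

lemma adjoin_mem: "x \<in> adjoin x"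
  unfolding adjoin_def using coeffs_in_monom[OF one_mem, of 1]
  by (intro CollectI exI[of _ "monom 1 1"]) (simp add: poly_monom)

end

text \<open>A subring that is maximal among those not containing the inverse of \<open>t\<close>; such a ring is a
  valuation ring whose maximal ideal contains \<open>t\<close>.\<close>

locale max_subring = subring_of_field R for R :: "'a :: field set" +
  fixes t :: 'a
  assumes t_mem: "t \<in> R" and inverse_t_notin: "inverse t \<notin> R"
    and maximal: "\<And>S. subring_of_field S \<Longrightarrow> R \<subseteq> S \<Longrightarrow> inverse t \<notin> S \<Longrightarrow> S = R"
begin

lemma t_nz: "t \<noteq> 0"
  using inverse_t_notin zero_mem by auto

lemma inverse_t_poly:
  assumes "x \<notin> R"
  obtains p where "coeffs_in R p" "poly p x = inverse t"
proof -
  have "inverse t \<in> adjoin x"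
    using maximal[OF adjoin_subring adjoin_incl] adjoin_mem assms by blast
  thus ?thesis using that by (auto simp: adjoin_def)
qed

text \<open>This puts t into the Jacobson radical. If s = 1 - t c were not invertible in R,
  maximality would put 1/t into R[1/s], and clearing denominators would give s^N / t in R. Since s^N
  is congruent to 1 modulo t R, also 1/t would lie in R.\<close>

lemma inverse_one_minus_mem:
  assumes "c \<in> R"
  shows "inverse (1 - t * c) \<in> R"
proof (rule ccontr)
  define s where "s = 1 - t * c"
  have s: "s \<in> R" unfolding s_def by (intro diff_mem one_mem mult_mem t_mem assms)
  have s0: "s \<noteq> 0"
  proof
    assume "s = 0"
    hence "t * c = 1" by (simp add: s_def)
    hence "inverse t = c" by (rule inverse_unique)
    thus False using inverse_t_notin assms by simp
  qed
  assume "inverse (1 - t * c) \<notin> R"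
  then obtain p where p: "coeffs_in R p" "poly p (inverse s) = inverse t"
    unfolding s_def by (rule inverse_t_poly)
  define N where "N = degree p"
  have "s ^ N * inverse t = (\<Sum>i\<le>N. coeff p i * s ^ (N - i))"
    unfolding p(2)[symmetric] poly_altdef sum_distrib_left N_def
    using s0 by (intro sum.cong) (auto simp: power_inverse power_diff field_simps)
  also have "\<dots> \<in> R"
    using p(1) s by (intro sum_mem mult_mem power_mem) (auto simp: coeffs_in_def)
  finally have sN: "s ^ N * inverse t \<in> R" .
  have "\<exists>d\<in>R. s ^ n = 1 - t * d" for n
  proof (induction n)
    case 0
    show ?case using zero_mem by (intro bexI[of _ 0]) auto
  next
    case (Suc n)
    then obtain d where d: "d \<in> R" "s ^ n = 1 - t * d" by blast
    have "s ^ Suc n = 1 - t * (c + d - t * c * d)"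
      unfolding power_Suc d(2) by (simp add: s_def algebra_simps)
    moreover have "c + d - t * c * d \<in> R"
      by (intro add_mem diff_mem mult_mem assms d t_mem)
    ultimately show ?case by blast
  qed
  then obtain d where d: "d \<in> R" "s ^ N = 1 - t * d" by blast
  have "inverse t = s ^ N * inverse t + d"
    using t_nz unfolding d(2) by (simp add: field_simps)
  thus False using inverse_t_notin add_mem[OF sN d(1)] by simp
qed

text \<open>If \<open>p(x) = t\<^sup>-\<^sup>1 = q(x\<^sup>-\<^sup>1)\<close> with \<open>deg q \<le> deg p\<close>, the second equation expresses \<open>x\<^sup>n\<close> through
  lower powers and so lowers the degree of \<open>p\<close>.\<close>

lemma reduce_degree:
  assumes p: "coeffs_in R p" "poly p x = inverse t"
    and q: "coeffs_in R q" "poly q (inverse x) = inverse t"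
    and le: "degree q \<le> degree p" and x0: "x \<noteq> 0"
  obtains p' where "coeffs_in R p'" "poly p' x = inverse t" "degree p' < degree p"
proof -
  define n where "n = degree p"
  define m where "m = degree q"
  define u where "u = inverse (1 - t * coeff q 0)"
  have u: "u \<in> R" unfolding u_def using q(1) by (intro inverse_one_minus_mem) (simp add: coeffs_in_def)
  have nz: "1 - t * coeff q 0 \<noteq> 0"
    using q(1) inverse_t_notin inverse_unique[of t "coeff q 0"] by (auto simp: coeffs_in_def)
  have pos: "m > 0"
  proof (rule ccontr)
    assume "\<not> m > 0"
    then obtain a where "q = [:a:]" by (metis degree_eq_zeroE m_def not_gr_zero)
    thus False using q inverse_t_notin by (auto simp: coeffs_in_def dest: spec[of _ 0])
  qed
  \<comment> \<open>The relation t q(1/x) = 1 is solved for 1 after moving the constant term of q to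
    the left, and then multiplied by x^n. The bound m <= n keeps the exponents n - j from being
    truncated.\<close>
  define r where "r = (\<Sum>j=1..m. monom (t * u * coeff q j) (n - j))"
  have cr: "coeffs_in R r"
    unfolding r_def using q(1) u
    by (intro coeffs_in_sum coeffs_in_monom mult_mem t_mem) (auto simp: coeffs_in_def)
  have "1 = t * poly q (inverse x)" using q(2) t_nz by simp
  also have "poly q (inverse x) = (\<Sum>j\<le>m. coeff q j * inverse x ^ j)"
    by (simp add: poly_altdef m_def)
  also have "\<dots> = coeff q 0 + (\<Sum>j=1..m. coeff q j * inverse x ^ j)"
    unfolding atMost_atLeast0 by (subst sum.atLeast_Suc_atMost) simp_all
  finally have "1 - t * coeff q 0 = t * (\<Sum>j=1..m. coeff q j * inverse x ^ j)"
    by (simp add: algebra_simps)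
  hence "1 = u * (t * (\<Sum>j=1..m. coeff q j * inverse x ^ j))"
    using nz by (simp add: u_def field_simps)
  hence "x ^ n = x ^ n * (u * (t * (\<Sum>j=1..m. coeff q j * inverse x ^ j)))"
    by simp
  also have "\<dots> = poly r x"
    unfolding r_def poly_sum sum_distrib_left poly_monom using le x0
    by (intro sum.cong) (auto simp: power_inverse power_diff field_simps n_def m_def)
  finally have rx: "poly r x = x ^ n" by simp
  define p' where "p' = p - monom (coeff p n) n + smult (coeff p n) r"
  have "coeffs_in R p'"
    unfolding p'_def using p(1) cr
    by (intro coeffs_in_add coeffs_in_diff coeffs_in_monom coeffs_in_smult) (auto simp: coeffs_in_def)
  moreover have "poly p' x = inverse t"
    using p(2) by (simp add: p'_def rx poly_monom)
  moreover have "degree p' < degree p"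
  proof -
    have n: "n > 0" using pos le by (simp add: n_def m_def)
    have "coeff r i = 0" if "i \<ge> n" for i
      unfolding r_def coeff_sum using that n by (intro sum.neutral) auto
    hence "coeff p' i = 0" if "i \<ge> n" for i
      using that by (cases "i = n") (auto simp: p'_def n_def coeff_eq_0)
    hence "degree p' \<le> n - 1" by (intro degree_le) auto
    thus ?thesis using n by (simp add: n_def)
  qed
  ultimately show ?thesis by (rule that)
qed

text \<open>Descent: if neither x nor 1/x were in R, then 1/t would be a polynomial in each of them.
  Of two such polynomials of minimal degree, the one of larger degree can be shortened by means of
  the other.\<close>

lemma valuation_ring: "x \<in> R \<or> inverse x \<in> R"
proof (rule ccontr)
  assume notin: "\<not> (x \<in> R \<or> inverse x \<in> R)"
  hence x0: "x \<noteq> 0" using zero_mem by auto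
  define P where "P = (\<lambda>y p. coeffs_in R p \<and> poly p y = inverse t)"
  have ex: "\<exists>p. P y p" if "y \<notin> R" for y
    using inverse_t_poly[OF that] unfolding P_def by metis
  obtain p0 q0 where pq0: "P x p0" "P (inverse x) q0" using ex notin by blast
  define p where "p = arg_min degree (P x)"
  define q where "q = arg_min degree (P (inverse x))"
  have p: "P x p" "\<And>p'. P x p' \<Longrightarrow> degree p \<le> degree p'"
    using arg_min_nat_lemma[of "P x" p0 degree, OF pq0(1)] unfolding p_def by blast+
  have q: "P (inverse x) q" "\<And>p'. P (inverse x) p' \<Longrightarrow> degree q \<le> degree p'"
    using arg_min_nat_lemma[of "P (inverse x)" q0 degree, OF pq0(2)] unfolding q_def by blast+
  have p1: "coeffs_in R p" "poly p x = inverse t" using p(1) by (simp_all add: P_def)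
  have q1: "coeffs_in R q" "poly q (inverse x) = inverse t" using q(1) by (simp_all add: P_def)
  show False
  proof (cases "degree q \<le> degree p")
    case True
    obtain p' where p': "coeffs_in R p'" "poly p' x = inverse t" "degree p' < degree p"
      by (rule reduce_degree[OF p1 q1 True x0])
    have "P x p'" using p'(1,2) by (simp add: P_def)
    from p(2)[OF this] p'(3) show False by simp
  next
    case False
    have le: "degree p \<le> degree q" and ix0: "inverse x \<noteq> 0" using False x0 by simp_all
    have p2: "poly p (inverse (inverse x)) = inverse t" using p1(2) by simp
    obtain q' where q': "coeffs_in R q'" "poly q' (inverse x) = inverse t" "degree q' < degree q"
      by (rule reduce_degree[OF q1 p1(1) p2 le ix0])
    have "P (inverse x) q'" using q'(1,2) by (simp add: P_def)
    from q(2)[OF this] q'(3) show False by simp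
  qed
qed

text \<open>A valuation ring is integrally closed: if 1/x is in R, dividing the equation by x^(n -
  1) writes x itself as a combination of powers of 1/x.\<close>

lemma monic_root_mem:
  assumes "\<And>i. i < n \<Longrightarrow> c i \<in> R" and root: "x ^ n = (\<Sum>i<n. c i * x ^ i)"
  shows "x \<in> R"
proof (rule ccontr)
  assume notin: "x \<notin> R"
  hence inv: "inverse x \<in> R" using valuation_ring by blast
  have x0: "x \<noteq> 0" using notin zero_mem by auto
  have "n > 0" using root by (cases n) auto
  hence "x = x ^ n * inverse x ^ (n - 1)"
    using x0 by (cases n) (auto simp: field_simps power_inverse)
  also have "\<dots> = (\<Sum>i<n. c i * inverse x ^ (n - 1 - i))"
    unfolding root sum_distrib_right
  proof (intro sum.cong refl)
    fix i assume "i \<in> {..<n}"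
    hence "n - 1 = (n - 1 - i) + i" by auto
    hence "inverse x ^ (n - 1) = inverse x ^ (n - 1 - i) * inverse x ^ i" by (metis power_add)
    moreover have "x ^ i * inverse x ^ i = 1" using x0 by (simp flip: power_mult_distrib)
    ultimately show "c i * x ^ i * inverse x ^ (n - 1) = c i * inverse x ^ (n - 1 - i)"
      by (simp only: mult.assoc mult.left_commute[of "x ^ i"] mult_1_right)
  qed
  also have "\<dots> \<in> R"
    using assms(1) inv by (intro sum_mem mult_mem power_mem) auto
  finally show False using notin by simp
qed

lemma power_mem_iff:
  assumes "n > 0"
  shows "x ^ n \<in> R \<longleftrightarrow> x \<in> R"
proof
  assume "x ^ n \<in> R"
  moreover have "x ^ n = (\<Sum>i<n. (if i = 0 then x ^ n else 0) * x ^ i)"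
    using assms by (cases n) (simp_all add: sum.lessThan_Suc_shift del: sum.lessThan_Suc)
  ultimately show "x \<in> R"
    using zero_mem by (intro monic_root_mem[of n "\<lambda>i. if i = 0 then x ^ n else 0" x]) simp_all
qed (rule power_mem)

end

lemma max_subring_exists:
  assumes "subring_of_field A" "t \<in> A" "inverse t \<notin> A"
  obtains R where "A \<subseteq> R" "max_subring R t"
proof -
  define \<A> where "\<A> = {S. subring_of_field S \<and> A \<subseteq> S \<and> inverse t \<notin> S}"
  have "\<exists>M\<in>\<A>. \<forall>S\<in>\<A>. M \<subseteq> S \<longrightarrow> S = M"
  proof (rule subset_Zorn_nonempty)
    show "\<A> \<noteq> {}" using assms by (auto simp: \<A>_def)
  next
    fix \<C> assume ne: "\<C> \<noteq> {}" and ch: "subset.chain \<A> \<C>"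
    have sub: "subring_of_field S" "A \<subseteq> S" "inverse t \<notin> S" if "S \<in> \<C>" for S
      using ch that by (auto simp: subset.chain_def \<A>_def)
    have pair: "\<exists>S\<in>\<C>. x \<in> S \<and> y \<in> S" if "x \<in> \<Union>\<C>" "y \<in> \<Union>\<C>" for x y
    proof -
      from that obtain S S' where S: "S \<in> \<C>" "S' \<in> \<C>" "x \<in> S" "y \<in> S'" by blast
      hence "S \<subseteq> S' \<or> S' \<subseteq> S" using ch unfolding subset_chain_def by blast
      thus ?thesis using S by blast
    qed
    have "subring_of_field (\<Union>\<C>)"
    proof
      show "1 \<in> \<Union>\<C>" using ne sub(1) subring_of_field.one_mem by blast
      show "- x \<in> \<Union>\<C>" if "x \<in> \<Union>\<C>" for x
        using that sub(1) subring_of_field.minus_mem by blast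
      show "x + y \<in> \<Union>\<C>" "x * y \<in> \<Union>\<C>" if "x \<in> \<Union>\<C>" "y \<in> \<Union>\<C>" for x y
        using pair[OF that] sub(1) subring_of_field.add_mem subring_of_field.mult_mem by blast+
    qed
    thus "\<Union>\<C> \<in> \<A>" using sub ne unfolding \<A>_def by blast
  qed
  then obtain R where R: "R \<in> \<A>" "\<And>S. S \<in> \<A> \<Longrightarrow> R \<subseteq> S \<Longrightarrow> S = R" by blast
  have "max_subring R t"
    using R assms(2) unfolding max_subring_def max_subring_axioms_def \<A>_def by blast
  thus ?thesis using R(1) that by (auto simp: \<A>_def)
qed

section \<open>From the valuation ring to a real-valued valuation\<close>

lemma fraction_between:
  assumes "a < (b :: real)"
  obtains p q where "q > 0" "a < real_of_int p / real q" "real_of_int p / real q < b"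
proof -
  obtain r where r: "r \<in> \<rat>" "a < r" "r < b" using Rats_dense_in_real[OF assms] by blast
  obtain p q where "r = real_of_int p / real q" "q \<noteq> 0"
    using r(1) unfolding Rats_eq_int_div_nat by blast
  thus ?thesis using r that[of q p] by simp
qed

text \<open>Absorption makes the rank one: it bounds the value of every x from below by a multiple
  of the value of t and, applied to 1/x, from above. Algebraic closedness supplies the roots of t
  that represent fractional values.\<close>

locale absorbing_max_subring = max_subring R t for R :: "'a :: alg_closed_field set" and t +
  assumes absorbing: "\<exists>n. t ^ n * x \<in> R"
begin

text \<open>\<open>ge x p q\<close> expresses that the valuation of \<open>x\<close> is at least \<open>p / q\<close>.\<close>

definition ge :: "'a \<Rightarrow> int \<Rightarrow> nat \<Rightarrow> bool" where
  "ge x p q \<longleftrightarrow> x ^ q * t powi (- p) \<in> R"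

lemma t_powi_mem_iff: "t powi k \<in> R \<longleftrightarrow> k \<ge> 0"
proof (cases "k \<ge> 0")
  case True
  then obtain n where "k = int n" by (metis nonneg_int_cases)
  thus ?thesis using power_mem[OF t_mem] by simp
next
  case False
  then obtain n where n: "k = - int (Suc n)" by (metis negD not_less)
  have "inverse t = t ^ n * t powi k"
    using t_nz by (simp add: n power_int_minus field_simps del: of_nat_Suc)
  hence "t powi k \<notin> R" using inverse_t_notin mult_mem[OF power_mem[OF t_mem]] by metis
  thus ?thesis using False by simp
qed

text \<open>R contains an element as soon as it contains a positive power of it, so
  \<open>ge\<close> depends only on the fraction p / q.\<close>

lemma ge_scale:
  assumes "k > 0"
  shows "ge x (p * int k) (q * k) \<longleftrightarrow> ge x p q"
proof -
  have "(x ^ q * t powi (- p)) ^ k = x ^ (q * k) * t powi (- p * int k)"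
    unfolding power_int_mult by (simp add: power_mult_distrib power_mult)
  thus ?thesis
    using power_mem_iff[OF assms, of "x ^ q * t powi (- p)"] by (simp add: ge_def)
qed

lemma ge_mono:
  assumes "ge x p q" "p' \<le> p"
  shows "ge x p' q"
proof -
  have "x ^ q * t powi (- p') = x ^ q * t powi (- p) * t powi (p - p')"
    using t_nz by (simp add: power_int_add[symmetric])
  moreover have "t powi (p - p') \<in> R" using assms(2) by (simp add: t_powi_mem_iff)
  ultimately show ?thesis using assms(1) mult_mem unfolding ge_def by metis
qed

lemma ge_mono_fraction:
  assumes "ge x p q" "q > 0" "q' > 0" "real_of_int p' / real q' \<le> real_of_int p / real q"
  shows "ge x p' q'"
proof -
  have "real_of_int (p' * int q) \<le> real_of_int (p * int q')"
    using assms(2-4) by (simp add: field_simps)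
  hence "p' * int q \<le> p * int q'" by (simp only: of_int_le_iff)
  moreover have "ge x (p * int q') (q * q')" using assms ge_scale by blast
  ultimately have "ge x (p' * int q) (q * q')" using ge_mono by blast
  thus ?thesis using ge_scale[OF assms(2), of x p' q'] by (simp add: mult.commute)
qed

lemma ge_mult:
  assumes "ge x p q" "ge y p' q"
  shows "ge (x * y) (p + p') q"
proof -
  have "(x * y) ^ q * t powi (- (p + p')) = (x ^ q * t powi (- p)) * (y ^ q * t powi (- p'))"
    using t_nz by (simp add: power_mult_distrib power_int_diff power_int_minus field_simps)
  thus ?thesis using assms mult_mem unfolding ge_def by metis
qed

text \<open>Dividing by a \<open>q\<close>-th root of \<open>t\<^sup>p\<close> reduces the claim to \<open>R\<close> being closed under addition.\<close>

lemma ge_add: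
  assumes "ge x p q" "ge y p q" "q > 0"
  shows "ge (x + y) p q"
proof -
  obtain z where z: "z ^ q = t powi p"
    using nth_root_exists[OF assms(3)] by blast
  have z0: "z \<noteq> 0" using z t_nz assms(3) by (metis power_0_left power_int_not_zero not_gr_zero)
  have "ge w p q \<longleftrightarrow> w / z \<in> R" for w
  proof -
    have "(w / z) ^ q = w ^ q * t powi (- p)"
      unfolding power_divide z by (simp add: power_int_minus divide_inverse)
    thus ?thesis using power_mem_iff[OF assms(3), of "w / z"] by (simp add: ge_def)
  qed
  thus ?thesis using assms(1,2) add_mem by (simp add: add_divide_distrib)
qed

lemma ge_inverse:
  assumes "\<not> ge x p q" "x \<noteq> 0"
  shows "ge (inverse x) (- p) q"
proof -
  have "inverse (x ^ q * t powi (- p)) \<in> R"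
    using assms(1) valuation_ring unfolding ge_def by blast
  thus ?thesis by (simp add: ge_def power_inverse power_int_minus mult.commute)
qed

text \<open>A lower Dedekind cut for nonzero x; its supremum is the value of x, normalized so that t
  has value 1.\<close>

definition exponents :: "'a \<Rightarrow> real set" where
  "exponents x = {real_of_int p / real q | p q. q > 0 \<and> ge x p q}"

definition exponent :: "'a \<Rightarrow> real" where
  "exponent x = Sup (exponents x)"

lemma exponents_nonempty: "exponents x \<noteq> {}"
proof -
  obtain n where "t ^ n * x \<in> R" using absorbing by blast
  hence "ge x (- int n) 1" by (simp add: ge_def mult.commute)
  thus ?thesis unfolding exponents_def by blast
qed

text \<open>Absorption is applied to the inverse: if t^n / x is integral, the value of x is at most
  n.\<close>

lemma bdd_above_exponents:
  assumes "x \<noteq> 0"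
  shows "bdd_above (exponents x)"
proof -
  obtain n where n: "t ^ n * inverse x \<in> R" using absorbing by blast
  have "real_of_int p / real q \<le> real n" if "q > 0" "ge x p q" for p q
  proof -
    have "(t ^ n * inverse x) ^ q * (x ^ q * t powi (- p)) = t powi (int (n * q) - p)"
      using assms t_nz
      by (simp add: power_mult_distrib power_int_diff power_int_minus power_inverse field_simps
          power_mult[symmetric] del: of_nat_mult)
    hence "t powi (int (n * q) - p) \<in> R"
      using that(2) n mult_mem power_mem unfolding ge_def by metis
    hence "p \<le> int (n * q)" by (simp add: t_powi_mem_iff)
    hence "real_of_int p \<le> real n * real q"
      by (metis of_int_le_iff of_int_of_nat_eq of_nat_mult)
    thus ?thesis using that(1) by (simp add: field_simps)
  qed
  thus ?thesis unfolding exponents_def bdd_above_def by blast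
qed

lemma exponent_upper:
  assumes "x \<noteq> 0" "q > 0" "ge x p q"
  shows "real_of_int p / real q \<le> exponent x"
  unfolding exponent_def using assms bdd_above_exponents
  by (intro cSup_upper) (auto simp: exponents_def)

lemma ge_below_exponent:
  assumes "x \<noteq> 0" "q > 0" "real_of_int p / real q < exponent x"
  shows "ge x p q"
proof -
  obtain r where r: "r \<in> exponents x" "real_of_int p / real q < r"
    using assms(3) less_cSup_iff[OF exponents_nonempty bdd_above_exponents[OF assms(1)]]
    unfolding exponent_def by blast
  then obtain p' q' where "r = real_of_int p' / real q'" "q' > 0" "ge x p' q'"
    by (auto simp: exponents_def)
  thus ?thesis using ge_mono_fraction[of x p' q' q p] r(2) assms(2) by simp
qed

lemma exponent_add:
  assumes "x \<noteq> 0" "y \<noteq> 0" "x + y \<noteq> 0"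
  shows "min (exponent x) (exponent y) \<le> exponent (x + y)"
proof (rule ccontr)
  assume "\<not> ?thesis"
  hence "exponent (x + y) < min (exponent x) (exponent y)" by (simp only: not_le)
  then obtain p q where pq: "q > 0" "exponent (x + y) < real_of_int p / real q"
      "real_of_int p / real q < min (exponent x) (exponent y)"
    by (rule fraction_between)
  hence "ge x p q" "ge y p q"
    using ge_below_exponent assms(1,2) by simp_all
  hence "ge (x + y) p q" using pq(1) by (rule ge_add)
  thus False using exponent_upper[OF assms(3) pq(1)] pq(2) by force
qed

lemma exponent_mult_ge:
  assumes "x \<noteq> 0" "y \<noteq> 0"
  shows "exponent x + exponent y \<le> exponent (x * y)"
proof (rule ccontr)
  \<comment> \<open>Half of the supposed gap, so that lower approximations of both exponents within
    \<open>e\<close> add up to more than \<open>exponent (x * y)\<close>.\<close>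
  define e where "e = (exponent x + exponent y - exponent (x * y)) / 2"
  assume "\<not> ?thesis"
  hence "e > 0" by (simp add: e_def)
  hence lt: "a - e < a" for a by simp
  obtain p q where pq: "q > 0" "exponent x - e < real_of_int p / real q"
      "real_of_int p / real q < exponent x"
    by (rule fraction_between[OF lt, of "exponent x"])
  obtain p' q' where pq': "q' > 0" "exponent y - e < real_of_int p' / real q'"
      "real_of_int p' / real q' < exponent y"
    by (rule fraction_between[OF lt, of "exponent y"])
  have "ge x p q" "ge y p' q'" using pq pq' assms ge_below_exponent by blast+
  hence "ge x (p * int q') (q * q')" "ge y (p' * int q) (q * q')"
    using ge_scale[of q' x p q] ge_scale[of q y p' q'] pq(1) pq'(1) by (simp_all add: mult.commute)
  hence "ge (x * y) (p * int q' + p' * int q) (q * q')" by (rule ge_mult)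
  hence "real_of_int (p * int q' + p' * int q) / real (q * q') \<le> exponent (x * y)"
    using assms pq(1) pq'(1) by (intro exponent_upper) auto
  moreover have "real_of_int (p * int q' + p' * int q) / real (q * q') =
      real_of_int p / real q + real_of_int p' / real q'"
    using pq(1) pq'(1) by (simp add: add_divide_distrib)
  ultimately have "exponent x - e + (exponent y - e) < exponent (x * y)"
    using pq(2) pq'(2) by linarith
  thus False by (simp add: e_def field_simps)
qed

lemma exponent_inverse_ge:
  assumes "x \<noteq> 0"
  shows "- exponent x \<le> exponent (inverse x)"
proof (rule ccontr)
  assume "\<not> ?thesis"
  hence "exponent (inverse x) < - exponent x" by simp
  then obtain p q where pq: "q > 0" "exponent (inverse x) < real_of_int p / real q"
      "real_of_int p / real q < - exponent x"
    by (rule fraction_between)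
  have "\<not> ge x (- p) q"
    using exponent_upper[OF assms pq(1), of "- p"] pq(3) by auto
  hence "ge (inverse x) p q" using ge_inverse[of x "- p" q] assms by simp
  thus False using exponent_upper[of "inverse x" q p] assms pq(1,2) by simp
qed

text \<open>The missing inequality comes from superadditivity for the product of x y and 1/y, since
  the exponent of 1/y is at least minus that of y.\<close>

lemma exponent_mult:
  assumes "x \<noteq> 0" "y \<noteq> 0"
  shows "exponent (x * y) = exponent x + exponent y"
proof -
  have "exponent (x * y) + exponent (inverse y) \<le> exponent (x * y * inverse y)"
    using assms by (intro exponent_mult_ge) auto
  also have "x * y * inverse y = x" using assms by simp
  finally show ?thesis
    using exponent_inverse_ge[OF assms(2)] exponent_mult_ge[OF assms] by linarith
qed

text \<open>This is what identifies the restriction to the 2-adic numbers, where every nonzero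
  element is a power of 2 times a unit.\<close>

lemma exponent_eq:
  assumes "u \<in> R" "inverse u \<in> R" "u \<noteq> 0"
  shows "exponent (t powi k * u) = of_int k"
proof -
  define x where "x = t powi k * u"
  have x0: "x \<noteq> 0" using assms t_nz by (simp add: x_def)
  have ge: "ge x p q \<longleftrightarrow> p \<le> k * int q" for p q
  proof -
    have eq: "x ^ q * t powi (- p) = t powi (k * int q - p) * u ^ q"
      using t_nz by (simp add: x_def power_mult_distrib power_int_mult power_int_diff
          power_int_minus field_simps)
    have eq': "t powi (k * int q - p) = x ^ q * t powi (- p) * inverse u ^ q"
      using assms(3) unfolding eq by (simp add: power_inverse)
    have "ge x p q \<longleftrightarrow> t powi (k * int q - p) \<in> R"
      unfolding ge_def using eq eq' mult_mem power_mem assms(1,2) by metis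
    thus ?thesis by (simp add: t_powi_mem_iff)
  qed
  have "of_int k \<le> exponent x"
    using exponent_upper[OF x0, of 1 k] ge by simp
  moreover have "\<not> of_int k < exponent x"
  proof
    assume "of_int k < exponent x"
    then obtain p q where pq: "q > 0" "of_int k < real_of_int p / real q"
        "real_of_int p / real q < exponent x"
      by (rule fraction_between)
    hence "ge x p q" using ge_below_exponent[OF x0] by blast
    hence "real_of_int p \<le> real_of_int (k * int q)" unfolding ge of_int_le_iff .
    thus False using pq(1,2) by (simp add: field_simps)
  qed
  ultimately show ?thesis by (simp add: x_def)
qed

definition valuation :: "'a \<Rightarrow> ereal" where
  "valuation x = (if x = 0 then \<infinity> else ereal (exponent x))"

lemma is_valuation: "is_valuation valuation"
  unfolding is_valuation_def
proof (intro conjI allI)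
  fix x y
  show "valuation (x * y) = valuation x + valuation y"
    by (simp add: valuation_def exponent_mult)
  show "min (valuation x) (valuation y) \<le> valuation (x + y)"
    using exponent_add[of x y] by (auto simp: valuation_def min_def split: if_splits)
qed (auto simp: valuation_def)

end

section \<open>A valuation on the algebraic closure that extends \<open>v2\<close>\<close>

definition zint :: "two_adic_closure set" where
  "zint = range (\<lambda>a. to_ac (to_fract a))"

lemma zint_subring: "subring_of_field zint"
proof
  show "1 \<in> zint" unfolding zint_def by (rule range_eqI[of _ _ 1]) simp
  fix x assume "x \<in> zint"
  then obtain a where x: "x = to_ac (to_fract a)" by (auto simp: zint_def)
  show "- x \<in> zint" unfolding x zint_def by (rule range_eqI[of _ _ "- a"]) simp
  fix y assume "y \<in> zint"
  then obtain b where y: "y = to_ac (to_fract b)" by (auto simp: zint_def)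
  show "x + y \<in> zint" unfolding x y zint_def by (rule range_eqI[of _ _ "a + b"]) simp
  show "x * y \<in> zint" unfolding x y zint_def by (rule range_eqI[of _ _ "a * b"]) simp
qed

lemma two_power_mult_integral:
  obtains m where "2 ^ m * (x :: two_adic) \<in> range to_fract"
proof (cases "x = 0")
  case True
  thus ?thesis using that[of 0] by (metis mult_zero_right rangeI to_fract_0)
next
  case False
  then obtain k u where x: "x = 2 powi k * to_fract u" "u dvd 1" by (rule two_adic_decomp)
  have "2 ^ nat (- k) * x = 2 ^ (nat (- k) + nat (k + int (nat (- k)))) / 2 ^ nat (- k) * to_fract u"
    unfolding x by (cases "k \<ge> 0") (auto simp: power_int_def power_add field_simps)
  also have "\<dots> = to_fract (2 ^ nat (k + int (nat (- k))) * u)"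
    by (simp add: power_add)
  finally show ?thesis using that by (metis rangeI)
qed

lemma two_power_mult_integral_all:
  obtains m where "\<And>i :: nat. i < n \<Longrightarrow> 2 ^ m * (b i :: two_adic) \<in> range to_fract"
proof -
  have "\<exists>m. \<forall>i<n. 2 ^ m * b i \<in> range to_fract"
  proof (induction n)
    case (Suc n)
    then obtain m where m: "\<forall>i<n. 2 ^ m * b i \<in> range to_fract" by blast
    obtain l where l: "2 ^ l * b n \<in> range to_fract" by (rule two_power_mult_integral)
    have up: "2 ^ (k + j) * x \<in> range to_fract" if "2 ^ k * x \<in> range to_fract" for x :: two_adic and k j
    proof -
      from that obtain a where "2 ^ k * x = to_fract a" by blast
      hence "2 ^ (k + j) * x = to_fract (2 ^ j * a)" by (simp add: power_add mult_ac)
      thus ?thesis by (rule range_eqI)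
    qed
    have "2 ^ (m + l) * b i \<in> range to_fract" if "i < Suc n" for i
      using that up[of m "b i" l] up[of l "b i" m] m l by (auto simp: less_Suc_eq add.commute)
    thus ?case by blast
  qed simp
  thus ?thesis using that by blast
qed

lemma v2_extension:
  obtains w :: "two_adic_closure \<Rightarrow> ereal" where "is_valuation w" "\<And>x. w (to_ac x) = v2 x"
proof -
  have "inverse 2 \<notin> zint"
  proof
    assume "inverse 2 \<in> zint"
    then obtain a :: two_adic_int where "inverse 2 = to_ac (to_fract a)"
      unfolding zint_def by blast
    hence "to_ac (inverse 2) = to_ac (to_fract a)"
      by (simp only: to_ac_inverse to_ac_numeral)
    hence "2 powi (- 1) * to_fract 1 = to_fract a"
      by (simp only: to_ac_eq_iff) (simp add: power_int_minus)
    thus False using two_powi_not_integral[of "- 1" 1 a] by simp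
  qed
  moreover have "2 \<in> zint"
    unfolding zint_def by (rule range_eqI[of _ _ 2]) simp
  ultimately obtain R where R: "zint \<subseteq> R" "max_subring R 2"
    using max_subring_exists[OF zint_subring] by blast
  interpret max_subring R 2 by (rule R(2))
  \<comment> \<open>An algebraic x becomes integral after multiplication by a power of 2: in the
    monic equation of 2^m x the coefficient of index i < n is multiplied by 2^(m (n - i)), hence at
    least by the common denominator 2^m.\<close>
  have "\<exists>n. 2 ^ n * x \<in> R" for x
  proof -
    obtain p :: "two_adic poly" where p: "p \<noteq> 0" "poly (map_poly to_ac p) x = 0"
      by (rule alg_closure_algebraic)
    define n where "n = degree p"
    define b where "b = (\<lambda>i. coeff p i / coeff p n)"
    obtain m where m: "\<And>i. i < n \<Longrightarrow> 2 ^ m * b i \<in> range to_fract"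
      using two_power_mult_integral_all[of n b] by blast
    have lc: "coeff p n \<noteq> 0" using p(1) by (simp add: n_def)
    have "(\<Sum>i\<le>n. to_ac (coeff p i) * x ^ i) = 0"
      using p(2) by (simp add: poly_altdef n_def coeff_map_poly degree_map_poly)
    hence "to_ac (coeff p n) * x ^ n = - (\<Sum>i<n. to_ac (coeff p i) * x ^ i)"
      by (simp add: lessThan_Suc_atMost[symmetric] eq_neg_iff_add_eq_0 add.commute)
    hence "x ^ n = - (\<Sum>i<n. to_ac (coeff p i) * x ^ i) / to_ac (coeff p n)"
      using lc by (simp add: field_simps)
    hence xn: "x ^ n = (\<Sum>i<n. - to_ac (b i) * x ^ i)"
      by (simp add: b_def sum_negf sum_divide_distrib)
    define c where "c = (\<lambda>i. - (2 ^ (m * (n - i - 1)) * to_ac (2 ^ m * b i)))"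
    have "(2 ^ m * x) ^ n = (\<Sum>i<n. c i * (2 ^ m * x) ^ i)"
      unfolding power_mult_distrib xn sum_distrib_left
    proof (intro sum.cong refl)
      fix i assume "i \<in> {..<n}"
      hence "n = (n - i - 1) + 1 + i" by auto
      hence "m * n = m * (n - i - 1) + m + m * i"
        by (metis distrib_left mult_1_right)
      hence "(2 :: two_adic_closure) ^ (m * n) = 2 ^ (m * (n - i - 1)) * 2 ^ m * 2 ^ (m * i)"
        by (simp only: power_add)
      thus "(2 ^ m) ^ n * (- to_ac (b i) * x ^ i) = c i * ((2 ^ m) ^ i * x ^ i)"
        by (simp add: c_def power_mult[symmetric])
    qed
    moreover have "c i \<in> R" if "i < n" for i
      unfolding c_def using m[OF that] R(1)
      by (intro minus_mem mult_mem power_mem t_mem) (auto simp: zint_def image_iff simp del: to_ac_mult)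
    ultimately have "2 ^ m * x \<in> R" using monic_root_mem[of n c] by blast
    thus ?thesis ..
  qed
  then interpret absorbing_max_subring R 2 by unfold_locales
  have "valuation (to_ac x) = v2 x" for x
  proof (cases "x = 0")
    case False
    then obtain k u where x: "x = 2 powi k * to_fract u" "u dvd 1" by (rule two_adic_decomp)
    obtain u' where u': "inverse (to_fract u) = to_fract u'" using x(2) by (rule unit_inverse)
    define y where "y = to_ac (to_fract u)"
    have "y \<in> R" using R(1) by (auto simp: zint_def y_def)
    moreover have "inverse y \<in> R"
      using R(1) unfolding y_def to_ac_inverse[symmetric] u' by (auto simp: zint_def)
    moreover have y0: "y \<noteq> 0" using x(2) by (auto simp: y_def)
    ultimately have "exponent (2 powi k * y) = of_int k" by (rule exponent_eq)
    moreover have "to_ac x = 2 powi k * y" by (simp add: x y_def power_int_def)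
    ultimately show ?thesis using False y0 v2_decomp[OF x(2), of k] x(1) by (simp add: valuation_def)
  qed (simp add: valuation_def)
  thus ?thesis using that is_valuation by blast
qed

section \<open>Quadratic subfields of the algebraic closure\<close>

lemma closure_ring_simps [simp]:
  "carrier (ring_of_type_algebra :: 'a :: field ring) = UNIV"
  "x \<otimes>\<^bsub>ring_of_type_algebra\<^esub> y = x * y"
  "x \<oplus>\<^bsub>ring_of_type_algebra\<^esub> y = x + y"
  "\<one>\<^bsub>ring_of_type_algebra\<^esub> = (1 :: 'a)"
  "\<zero>\<^bsub>ring_of_type_algebra\<^esub> = (0 :: 'a)"
  by (simp_all add: ring_of_type_algebra_def)

lemma closure_ring_minus [simp]: "\<ominus>\<^bsub>ring_of_type_algebra\<^esub> x = - (x :: 'a :: field)"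
proof -
  interpret field "ring_of_type_algebra :: 'a ring" by (rule field_from_type_algebra)
  show ?thesis by (rule minus_equality) simp_all
qed

lemma closure_ring_inv [simp]:
  assumes "(x :: 'a :: field) \<noteq> 0"
  shows "inv\<^bsub>ring_of_type_algebra\<^esub> x = inverse x"
proof -
  interpret field "ring_of_type_algebra :: 'a ring" by (rule field_from_type_algebra)
  show ?thesis using comm_inv_char[of x "inverse x"] assms by simp
qed

lemma subfield_closure_ringI:
  assumes "1 \<in> F" "\<And>x y. x \<in> F \<Longrightarrow> y \<in> F \<Longrightarrow> x + y \<in> F" "\<And>x. x \<in> F \<Longrightarrow> - x \<in> F"
    "\<And>x y. x \<in> F \<Longrightarrow> y \<in> F \<Longrightarrow> x * y \<in> F" "\<And>x. x \<in> F \<Longrightarrow> x \<noteq> 0 \<Longrightarrow> inverse x \<in> F"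
  shows "subfield F (ring_of_type_algebra :: 'a :: field ring)"
proof -
  interpret field "ring_of_type_algebra :: 'a ring" by (rule field_from_type_algebra)
  show ?thesis using assms by (intro subfieldI' subringI) auto
qed

lemma subfield_closure_ringD:
  assumes "subfield F (ring_of_type_algebra :: 'a :: field ring)"
  shows "0 \<in> F" "1 \<in> F" "\<And>x y. x \<in> F \<Longrightarrow> y \<in> F \<Longrightarrow> x + y \<in> F" "\<And>x. x \<in> F \<Longrightarrow> - x \<in> F"
    "\<And>x y. x \<in> F \<Longrightarrow> y \<in> F \<Longrightarrow> x * y \<in> F" "\<And>x. x \<in> F \<Longrightarrow> inverse x \<in> F"
proof -
  interpret field "ring_of_type_algebra :: 'a ring" by (rule field_from_type_algebra)
  note sub = subringE[OF subfieldE(1)[OF assms]]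
  show "0 \<in> F" using sub(2) by simp
  show "1 \<in> F" using sub(3) by simp
  show "x + y \<in> F" if "x \<in> F" "y \<in> F" for x y using sub(7)[OF that] by simp
  show "- x \<in> F" if "x \<in> F" for x using sub(5)[OF that] by simp
  show "x * y \<in> F" if "x \<in> F" "y \<in> F" for x y using sub(6)[OF that] by simp
  show "inverse x \<in> F" if "x \<in> F" for x
    using subfield_m_inv(1)[OF assms, of x] that \<open>0 \<in> F\<close> by (cases "x = 0") auto
qed

lemma to_ac_in_Q2 [simp]: "to_ac x \<in> Q2"
  by (simp add: Q2_def)

lemma subfield_Q2: "subfield Q2 closure_ring"
proof (rule subfield_closure_ringI)
  show "1 \<in> Q2" using to_ac_in_Q2[of 1] by simp
  fix x assume "x \<in> Q2"
  then obtain a where x: "x = to_ac a" by (auto simp: Q2_def)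
  show "- x \<in> Q2" using to_ac_in_Q2[of "- a"] x by simp
  show "inverse x \<in> Q2" using to_ac_in_Q2[of "inverse a"] x by simp
  fix y assume "y \<in> Q2"
  then obtain b where y: "y = to_ac b" by (auto simp: Q2_def)
  show "x + y \<in> Q2" using to_ac_in_Q2[of "a + b"] x y by simp
  show "x * y \<in> Q2" using to_ac_in_Q2[of "a * b"] x y by simp
qed

lemma subfield_adjoin_Q2: "subfield (adjoin_Q2 S) closure_ring"
proof -
  interpret field closure_ring by (rule field_from_type_algebra)
  show ?thesis unfolding adjoin_Q2_def by (rule generate_field_is_subfield) simp
qed

lemma adjoin_Q2_incl: "Q2 \<union> S \<subseteq> adjoin_Q2 S"
  unfolding adjoin_Q2_def by (auto intro: generate_field.incl)

lemma adjoin_Q2_subset: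
  assumes "subfield F closure_ring" "Q2 \<subseteq> F" "S \<subseteq> F"
  shows "adjoin_Q2 S \<subseteq> F"
proof -
  interpret field closure_ring by (rule field_from_type_algebra)
  show ?thesis unfolding adjoin_Q2_def using assms by (intro generate_field_min_subfield1) auto
qed

lemma adjoin_Q2_eqI: "S \<subseteq> adjoin_Q2 T \<Longrightarrow> T \<subseteq> adjoin_Q2 S \<Longrightarrow> adjoin_Q2 S = adjoin_Q2 T"
  using adjoin_Q2_subset[OF subfield_adjoin_Q2] adjoin_Q2_incl
  by (metis Un_subset_iff subset_antisym)

lemma adjoin_Q2_eq_Q2: "S \<subseteq> Q2 \<Longrightarrow> adjoin_Q2 S = Q2"
  using adjoin_Q2_subset[OF subfield_Q2] adjoin_Q2_incl by blast

lemma adjoin_Q2_affine: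
  assumes "q \<noteq> 0"
  shows "adjoin_Q2 {to_ac p + to_ac q * x} = adjoin_Q2 {x}"
proof (rule adjoin_Q2_eqI)
  note D = subfield_closure_ringD[OF subfield_adjoin_Q2]
  show "{to_ac p + to_ac q * x} \<subseteq> adjoin_Q2 {x}"
    using D(3,5) adjoin_Q2_incl to_ac_in_Q2 by (simp add: subset_iff)
  define y where "y = to_ac p + to_ac q * x"
  have "to_ac (inverse q) * (y + to_ac (- p)) \<in> adjoin_Q2 {y}"
    using D(3,5) adjoin_Q2_incl to_ac_in_Q2 by (simp add: subset_iff del: to_ac_minus to_ac_inverse)
  also have "to_ac (inverse q) * (y + to_ac (- p)) = x"
    using assms by (simp add: y_def)
  finally show "{x} \<subseteq> adjoin_Q2 {to_ac p + to_ac q * x}" by (simp add: y_def)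
qed

lemma adjoin_Q2_sqrt_eq:
  assumes "x\<^sup>2 = to_ac c ^ 2 * y\<^sup>2" "c \<noteq> 0"
  shows "adjoin_Q2 {x} = adjoin_Q2 {y}"
proof -
  have "x\<^sup>2 = (to_ac c * y)\<^sup>2" using assms(1) by (simp add: power_mult_distrib)
  hence "x = to_ac 0 + to_ac c * y \<or> x = to_ac 0 + to_ac (- c) * y"
    by (simp add: power2_eq_iff)
  thus ?thesis
  proof
    assume x: "x = to_ac 0 + to_ac c * y"
    show ?thesis unfolding x using assms(2) by (rule adjoin_Q2_affine)
  next
    assume x: "x = to_ac 0 + to_ac (- c) * y"
    show ?thesis unfolding x using assms(2) by (intro adjoin_Q2_affine) simp
  qed
qed

section \<open>Quadratic fields in coordinates\<close>

text \<open>A mere span, defined for arbitrary \<open>\<theta>\<close>, so that elements carry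
  coordinates; for a quadratic \<open>\<theta>\<close> it turns out to be the generated
  field.\<close>

definition quad :: "two_adic_closure \<Rightarrow> two_adic_closure set" where
  "quad \<theta> = {to_ac x + to_ac y * \<theta> | x y. True}"

lemma quadI: "to_ac x + to_ac y * \<theta> \<in> quad \<theta>"
  by (auto simp: quad_def)

lemma Q2_subset_quad: "Q2 \<subseteq> quad \<theta>"
  using quadI[of _ 0] by (auto simp: Q2_def)

lemma quad_self: "\<theta> \<in> quad \<theta>"
  using quadI[of 0 1 \<theta>] by simp

locale quadratic =
  fixes \<theta> :: two_adic_closure and a b :: two_adic
  assumes root: "\<theta>\<^sup>2 + to_ac a * \<theta> + to_ac b = 0"
    and notin_Q2: "\<theta> \<notin> Q2"
begin

abbreviation "L \<equiv> quad \<theta>"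

abbreviation "\<theta>' \<equiv> - to_ac a - \<theta>"

lemma sq: "\<theta> * \<theta> = - to_ac a * \<theta> - to_ac b"
  using root by (simp add: power2_eq_square algebra_simps eq_neg_iff_add_eq_0)

lemma sq': "\<theta>' * \<theta>' = - to_ac a * \<theta>' - to_ac b"
  by (simp add: algebra_simps sq)

lemma coords_eq_iff:
  "to_ac x + to_ac y * \<theta> = to_ac x' + to_ac y' * \<theta> \<longleftrightarrow> x = x' \<and> y = y'"
proof
  assume eq: "to_ac x + to_ac y * \<theta> = to_ac x' + to_ac y' * \<theta>"
  have "y = y'"
  proof (rule ccontr)
    assume "y \<noteq> y'"
    hence nz: "to_ac y - to_ac y' \<noteq> 0" by simp
    have "(to_ac y - to_ac y') * \<theta> = to_ac x' - to_ac x"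
      using eq by (simp add: algebra_simps)
    hence "\<theta> = to_ac ((x' - x) / (y - y'))"
      using nz by (simp add: field_simps)
    thus False using notin_Q2 to_ac_in_Q2 by metis
  qed
  thus "x = x' \<and> y = y'" using eq by simp
qed auto

lemma theta'_neq: "\<theta>' \<noteq> \<theta>"
proof
  assume "\<theta>' = \<theta>"
  hence "\<theta> = to_ac (- a / 2)" by (simp add: field_simps)
  thus False using notin_Q2 to_ac_in_Q2 by metis
qed

text \<open>The second factor is the conjugate \<open>to_ac x + to_ac y * \<theta>'\<close> of the
  first, rewritten in the basis 1, \<open>\<theta>\<close>. The norm on the right yields the
  inverses in L.\<close>

lemma norm_eq:
  "(to_ac x + to_ac y * \<theta>) * (to_ac (x - a * y) + to_ac (- y) * \<theta>) = to_ac (x\<^sup>2 - a * x * y + b * y\<^sup>2)"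
proof -
  have "(to_ac x + to_ac y * \<theta>) * (to_ac (x - a * y) + to_ac (- y) * \<theta>) =
      to_ac x * to_ac x - to_ac a * to_ac x * to_ac y - to_ac a * to_ac y * to_ac y * \<theta>
        - to_ac y * to_ac y * (\<theta> * \<theta>)"
    by (simp add: algebra_simps)
  also have "\<dots> = to_ac (x\<^sup>2 - a * x * y + b * y\<^sup>2)"
    unfolding sq by (simp add: algebra_simps power2_eq_square)
  finally show ?thesis .
qed

lemma mult_eq:
  "(to_ac x + to_ac y * \<theta>) * (to_ac x' + to_ac y' * \<theta>) =
    to_ac (x * x' - b * y * y') + to_ac (x * y' + y * x' - a * y * y') * \<theta>"
proof -
  have "(to_ac x + to_ac y * \<theta>) * (to_ac x' + to_ac y' * \<theta>) =
      to_ac x * to_ac x' + (to_ac x * to_ac y' + to_ac y * to_ac x') * \<theta> + to_ac y * to_ac y' * (\<theta> * \<theta>)"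
    by (simp add: algebra_simps)
  thus ?thesis unfolding sq by (simp add: algebra_simps)
qed

lemma subfield_L: "subfield L closure_ring"
proof (rule subfield_closure_ringI)
  show "1 \<in> L" using quadI[of 1 0] by simp
  fix z assume "z \<in> L"
  then obtain x y where z: "z = to_ac x + to_ac y * \<theta>" by (auto simp: quad_def)
  show "- z \<in> L" using quadI[of "- x" "- y" \<theta>] z by simp
  show "inverse z \<in> L" if "z \<noteq> 0"
  proof -
    define N where "N = x\<^sup>2 - a * x * y + b * y\<^sup>2"
    have "to_ac (x - a * y) + to_ac (- y) * \<theta> \<noteq> 0"
    proof
      assume "to_ac (x - a * y) + to_ac (- y) * \<theta> = 0"
      hence "x - a * y = 0 \<and> - y = 0" using coords_eq_iff[of "x - a * y" "- y" 0 0] by simp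
      thus False using z that by simp
    qed
    hence "to_ac N \<noteq> 0" using norm_eq[of x y] z that unfolding N_def by (metis mult_eq_0_iff)
    hence "inverse z = to_ac (inverse N) * (to_ac (x - a * y) + to_ac (- y) * \<theta>)"
      using norm_eq[of x y] unfolding N_def[symmetric] z[symmetric]
      by (intro inverse_unique) (simp add: field_simps)
    also have "\<dots> = to_ac ((x - a * y) / N) + to_ac (- y / N) * \<theta>"
      by (simp add: divide_inverse algebra_simps)
    finally show ?thesis by (simp only: quadI)
  qed
  fix w assume "w \<in> L"
  then obtain x' y' where w: "w = to_ac x' + to_ac y' * \<theta>" by (auto simp: quad_def)
  have "z + w = to_ac (x + x') + to_ac (y + y') * \<theta>" by (simp add: z w algebra_simps)
  thus "z + w \<in> L" using quadI by metis
  show "z * w \<in> L" unfolding z w mult_eq by (rule quadI)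
qed

lemma adjoin_eq_quad: "adjoin_Q2 {\<theta>} = L"
proof
  show "adjoin_Q2 {\<theta>} \<subseteq> L"
    using adjoin_Q2_subset[OF subfield_L Q2_subset_quad] quad_self by simp
  note D = subfield_closure_ringD[OF subfield_adjoin_Q2[of "{\<theta>}"]]
  show "L \<subseteq> adjoin_Q2 {\<theta>}"
    using D(3,5) adjoin_Q2_incl[of "{\<theta>}"] by (auto simp: quad_def subset_iff)
qed

lemma L_neq_Q2: "L \<noteq> Q2"
  using notin_Q2 quad_self by auto

lemma dimension_L: "ring.dimension closure_ring 2 Q2 L"
proof -
  interpret field closure_ring by (rule field_from_type_algebra)
  have le: "line_extension Q2 1 {0} = Q2"
    by (auto simp: line_extension_mem_iff)
  have "dimension (Suc 0) Q2 (line_extension Q2 1 {0})"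
    by (rule Suc_dim) (use zero_dim[of Q2] in simp_all)
  hence "dimension (Suc (Suc 0)) Q2 (line_extension Q2 \<theta> Q2)"
    unfolding le using notin_Q2 by (intro Suc_dim) simp_all
  moreover have "line_extension Q2 \<theta> Q2 = L"
    by (auto simp: line_extension_mem_iff quad_def Q2_def add.commute) (metis add.commute)+
  ultimately show ?thesis by (simp add: numeral_2_eq_2)
qed

text \<open>The description is well defined since coordinates are unique. The restriction to L makes
  the map extensional, as \<open>embeddings\<close> demands.\<close>

definition conj :: "two_adic_closure \<Rightarrow> two_adic_closure" where
  "conj = (\<lambda>z\<in>L. THE w. \<exists>x y. z = to_ac x + to_ac y * \<theta> \<and> w = to_ac x + to_ac y * \<theta>')"

lemma conj_eq: "conj (to_ac x + to_ac y * \<theta>) = to_ac x + to_ac y * \<theta>'"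
proof -
  have "(THE w. \<exists>x' y'. to_ac x + to_ac y * \<theta> = to_ac x' + to_ac y' * \<theta> \<and>
      w = to_ac x' + to_ac y' * \<theta>') = to_ac x + to_ac y * \<theta>'"
    by (rule the_equality) (auto simp: coords_eq_iff)
  thus ?thesis by (simp add: conj_def quadI)
qed

lemma conj_theta: "conj \<theta> = \<theta>'"
  using conj_eq[of 0 1] by simp

lemma embeddings_eq: "embeddings L Q2 = {restrict id L, conj}"
proof
  show "{restrict id L, conj} \<subseteq> embeddings L Q2"
  proof -
    have "conj \<in> ring_hom (closure_ring\<lparr>carrier := L\<rparr>) closure_ring"
    proof (rule ring_hom_memI)
      show "conj \<one>\<^bsub>closure_ring\<lparr>carrier := L\<rparr>\<^esub> = \<one>\<^bsub>closure_ring\<^esub>"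
        using conj_eq[of 1 0] by simp
      fix z w assume "z \<in> carrier (closure_ring\<lparr>carrier := L\<rparr>)" "w \<in> carrier (closure_ring\<lparr>carrier := L\<rparr>)"
      then obtain x y x' y' where z: "z = to_ac x + to_ac y * \<theta>" and w: "w = to_ac x' + to_ac y' * \<theta>"
        by (auto simp: quad_def)
      have "conj (z * w) = conj z * conj w"
      proof -
        have "conj z * conj w = to_ac x * to_ac x' + (to_ac x * to_ac y' + to_ac y * to_ac x') * \<theta>'
            + to_ac y * to_ac y' * (\<theta>' * \<theta>')"
          unfolding z w conj_eq by (simp add: algebra_simps)
        also have "\<dots> = conj (z * w)"
          unfolding sq' z w mult_eq conj_eq by (simp add: algebra_simps)
        finally show ?thesis by simp
      qed
      thus "conj (z \<otimes>\<^bsub>closure_ring\<lparr>carrier := L\<rparr>\<^esub> w) = conj z \<otimes>\<^bsub>closure_ring\<^esub> conj w" by simp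
      have "z + w = to_ac (x + x') + to_ac (y + y') * \<theta>" by (simp add: z w algebra_simps)
      hence "conj (z + w) = to_ac (x + x') + to_ac (y + y') * \<theta>'" by (simp only: conj_eq)
      hence "conj (z + w) = conj z + conj w"
        unfolding z w conj_eq by (simp add: algebra_simps)
      thus "conj (z \<oplus>\<^bsub>closure_ring\<lparr>carrier := L\<rparr>\<^esub> w) = conj z \<oplus>\<^bsub>closure_ring\<^esub> conj w" by simp
    qed simp
    moreover have "conj (to_ac x) = to_ac x" for x using conj_eq[of x 0] by simp
    ultimately have "conj \<in> embeddings L Q2"
      by (auto simp: embeddings_def Q2_def conj_def)
    moreover have "restrict id L \<in> embeddings L Q2"
      using Q2_subset_quad subfield_closure_ringD[OF subfield_L]
      by (auto simp: embeddings_def intro!: ring_hom_memI)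
    ultimately show ?thesis by simp
  qed
  show "embeddings L Q2 \<subseteq> {restrict id L, conj}"
  proof
    fix \<sigma> assume \<sigma>: "\<sigma> \<in> embeddings L Q2"
    have hom: "\<sigma> \<in> ring_hom (closure_ring\<lparr>carrier := L\<rparr>) closure_ring" and ext: "\<sigma> \<in> extensional L"
      and fx: "\<sigma> (to_ac x) = to_ac x" for x
      using \<sigma> by (auto simp: embeddings_def)
    have add: "\<sigma> (z + w) = \<sigma> z + \<sigma> w" and mult: "\<sigma> (z * w) = \<sigma> z * \<sigma> w" if "z \<in> L" "w \<in> L" for z w
      using ring_hom_add[OF hom, of z w] ring_hom_mult[OF hom, of z w] that by simp_all
    note D = subfield_closure_ringD[OF subfield_L]
    have acL: "to_ac x \<in> L" for x using quadI[of x 0] by simp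
    have lin: "\<sigma> (to_ac x + to_ac y * \<theta>) = to_ac x + to_ac y * \<sigma> \<theta>" for x y
      using add[of "to_ac x" "to_ac y * \<theta>"] mult[of "to_ac y" \<theta>] fx acL quad_self D(5) by simp
    have "\<sigma> \<theta> * \<sigma> \<theta> = \<sigma> (\<theta> * \<theta>)" using mult quad_self by simp
    also have "\<theta> * \<theta> = to_ac (- b) + to_ac (- a) * \<theta>" using sq by simp
    also have "\<sigma> \<dots> = to_ac (- b) + to_ac (- a) * \<sigma> \<theta>" by (rule lin)
    finally have s: "\<sigma> \<theta> * \<sigma> \<theta> = - to_ac b - to_ac a * \<sigma> \<theta>" by simp
    \<comment> \<open>An embedding fixes the coefficients, so it sends \<open>\<theta>\<close> to a
      root of the same polynomial, which factors as (X - \<open>\<theta>\<close>) (X -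
      \<open>\<theta>'\<close>).\<close>
    have "(\<sigma> \<theta> - \<theta>) * (\<sigma> \<theta> - \<theta>') = \<sigma> \<theta> * \<sigma> \<theta> + to_ac a * \<sigma> \<theta> - to_ac a * \<theta> - \<theta> * \<theta>"
      by (simp add: algebra_simps)
    also have "\<dots> = 0" unfolding s sq by (simp add: algebra_simps)
    finally have "\<sigma> \<theta> = \<theta> \<or> \<sigma> \<theta> = \<theta>'" by simp
    thus "\<sigma> \<in> {restrict id L, conj}"
    proof
      assume "\<sigma> \<theta> = \<theta>"
      hence "\<sigma> z = restrict id L z" for z
        using ext by (cases "z \<in> L") (auto simp: quad_def lin extensional_def)
      thus ?thesis by blast
    next
      assume t: "\<sigma> \<theta> = \<theta>'"
      have "\<sigma> z = conj z" for z
      proof (cases "z \<in> L")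
        case True
        then obtain x y where "z = to_ac x + to_ac y * \<theta>" by (auto simp: quad_def)
        thus ?thesis by (simp only: lin conj_eq t)
      next
        case False
        thus ?thesis using ext by (auto simp: extensional_def conj_def)
      qed
      thus ?thesis by blast
    qed
  qed
qed

end

section \<open>Ramification of quadratic extensions\<close>

context
  fixes v :: "'a :: field \<Rightarrow> ereal"
  assumes v: "is_valuation v"
begin

lemma valuation_eq_infinity_iff: "v x = \<infinity> \<longleftrightarrow> x = 0"
  and valuation_mult: "v (x * y) = v x + v y"
  and valuation_add: "min (v x) (v y) \<le> v (x + y)"
  using v by (auto simp: is_valuation_def)

lemma valuation_0: "v 0 = \<infinity>"
  by (simp add: valuation_eq_infinity_iff)

lemma valuation_real:
  assumes "x \<noteq> 0"
  obtains r where "v x = ereal r"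
  using v assms that by (cases "v x") (auto simp: is_valuation_def)

lemma valuation_1: "v 1 = 0"
proof -
  obtain r where "v 1 = ereal r" by (rule valuation_real[of 1]) auto
  thus ?thesis using valuation_mult[of 1 1] by (simp add: zero_ereal_def)
qed

lemma valuation_minus: "v (- x) = v x"
proof -
  obtain r where r: "v (- 1) = ereal r" by (rule valuation_real[of "- 1"]) auto
  have "v (- 1) = 0"
    using valuation_mult[of "- 1" "- 1"] r by (simp add: valuation_1 zero_ereal_def)
  thus ?thesis using valuation_mult[of "- 1" x] by simp
qed

lemma valuation_add_eq:
  assumes "v x < v y"
  shows "v (x + y) = v x"
proof (rule antisym)
  show "v x \<le> v (x + y)" using valuation_add[of x y] assms by (simp add: min_def split: if_splits)
  have "min (v (x + y)) (v y) \<le> v x"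
    using valuation_add[of "x + y" "- y"] by (simp add: valuation_minus)
  thus "v (x + y) \<le> v x" using assms by (auto simp: min_le_iff_disj dest: leD)
qed

lemma valuation_add_neq:
  assumes "v x \<noteq> v y"
  shows "v (x + y) = min (v x) (v y)"
  using assms valuation_add_eq[of x y] valuation_add_eq[of y x]
  by (auto simp: min_def add.commute not_le)

lemma is_valuation_scale:
  assumes "c > 0"
  shows "is_valuation (\<lambda>x. ereal c * v x)"
  unfolding is_valuation_def
proof (intro conjI allI)
  fix x y
  show "ereal c * v x = \<infinity> \<longleftrightarrow> x = 0"
    using assms by (cases "x = 0") (auto simp: valuation_0 elim!: valuation_real)
  show "ereal c * v x \<noteq> - \<infinity>"
    using assms by (cases "x = 0") (auto simp: valuation_0 elim!: valuation_real)
  show "ereal c * v (x * y) = ereal c * v x + ereal c * v y"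
  proof (cases "x = 0 \<or> y = 0")
    case True
    moreover have "ereal c * v z \<noteq> - \<infinity>" for z
      using assms by (cases "z = 0") (auto simp: valuation_0 elim!: valuation_real)
    ultimately show ?thesis using assms by (auto simp: valuation_0)
  next
    case False
    then obtain r q where "v x = ereal r" "v y = ereal q" using valuation_real by metis
    thus ?thesis by (simp add: valuation_mult distrib_left)
  qed
  have "min (ereal c * v x) (ereal c * v y) \<le> ereal c * min (v x) (v y)"
    using linear[of "v x" "v y"] by (auto simp: min_absorb1 min_absorb2)
  also have "\<dots> \<le> ereal c * v (x + y)"
    using assms by (intro ereal_mult_left_mono valuation_add) simp
  finally show "min (ereal c * v x) (ereal c * v y) \<le> ereal c * v (x + y)" .
qed

end

text \<open>The basis \<open>1, \<theta>\<close> is orthogonal for every extension of the 2-adic valuation. Knowing this for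
  all extensions makes their uniqueness superfluous.\<close>

definition gauss_basis :: "two_adic_closure \<Rightarrow> real \<Rightarrow> bool" where
  "gauss_basis \<theta> s \<longleftrightarrow> (\<forall>v c x y. is_valuation v \<longrightarrow> c > 0 \<longrightarrow> (\<forall>x. v (to_ac x) = ereal c * v2 x) \<longrightarrow>
     v (to_ac x + to_ac y * \<theta>) = ereal c * min (v2 x) (v2 y + ereal s))"

lemma gauss_basisD:
  assumes "gauss_basis \<theta> s" "is_valuation v" "c > 0" "\<And>x. v (to_ac x) = ereal c * v2 x"
  shows "v (to_ac x + to_ac y * \<theta>) = ereal c * min (v2 x) (v2 y + ereal s)"
  using assms unfolding gauss_basis_def by blast

text \<open>In \<open>\<theta>\<close>^2 + a \<open>\<theta>\<close> + b = 0 no term can have a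
  strictly smaller value than both others, which leaves only c/2 for the value of
  \<open>\<theta>\<close>. The values of x and y \<open>\<theta>\<close> then lie in c Z and c (Z +
  1/2), so they never tie and their minimum is the value of the sum.\<close>

lemma gauss_basis_eisenstein:
  assumes root: "\<theta>\<^sup>2 + to_ac a * \<theta> + to_ac b = 0" and a: "v2 a \<ge> 1" and b: "v2 b = 1"
  shows "gauss_basis \<theta> (1 / 2)"
  unfolding gauss_basis_def
proof (intro allI impI)
  fix v c x y
  assume v: "is_valuation v" and c: "(c :: real) > 0" and ext: "\<forall>x. v (to_ac x) = ereal c * v2 x"
  note [simp] = valuation_mult[OF v] valuation_minus[OF v] valuation_0[OF v]
  have "b \<noteq> 0" using b by auto
  hence "\<theta> \<noteq> 0" using root by auto
  then obtain t where t: "v \<theta> = ereal t" by (rule valuation_real[OF v])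
  have vb: "v (to_ac b) = ereal c" using ext b by simp
  have "ereal c * 1 \<le> ereal c * v2 a" using a c by (intro ereal_mult_left_mono) auto
  hence va: "v (to_ac a * \<theta>) \<ge> ereal (c + t)"
    using ext t by (cases "ereal c * v2 a") auto
  have sq: "\<theta> * \<theta> = - (to_ac a * \<theta> + to_ac b)"
    unfolding eq_neg_iff_add_eq_0 using root by (simp add: power2_eq_square add.assoc)
  have vt: "v (\<theta> * \<theta>) = ereal (2 * t)" using t by simp
  have "\<not> t < c / 2"
  proof
    assume "t < c / 2"
    have "ereal (2 * t) = v (\<theta> * \<theta>)" using t by simp
    also have "\<dots> = v (to_ac a * \<theta> + to_ac b)" unfolding sq by (rule valuation_minus[OF v])
    also have "\<dots> \<ge> min (v (to_ac a * \<theta>)) (v (to_ac b))" by (rule valuation_add[OF v])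
    finally have "ereal (2 * t) \<ge> ereal (c + t) \<or> ereal (2 * t) \<ge> ereal c"
      using va unfolding vb min_le_iff_disj by (metis order_trans)
    thus False using \<open>t < c / 2\<close> c by auto
  qed
  moreover have "\<not> t > c / 2"
  proof
    assume "t > c / 2"
    have "to_ac b = - (\<theta> * \<theta> + to_ac a * \<theta>)" using sq by simp
    hence "ereal c = v (\<theta> * \<theta> + to_ac a * \<theta>)" using vb by (metis valuation_minus[OF v])
    also have "\<dots> \<ge> min (v (\<theta> * \<theta>)) (v (to_ac a * \<theta>))" by (rule valuation_add[OF v])
    finally have "ereal c \<ge> ereal (2 * t) \<or> ereal c \<ge> ereal (c + t)"
      using va unfolding vt min_le_iff_disj by (metis order_trans)
    thus False using \<open>t > c / 2\<close> c by auto
  qed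
  ultimately have t': "t = c / 2" by simp
  show "v (to_ac x + to_ac y * \<theta>) = ereal c * min (v2 x) (v2 y + ereal (1 / 2))"
  proof (cases "x = 0 \<or> y = 0")
    case True
    thus ?thesis
    proof
      assume "x = 0"
      show ?thesis
      proof (cases "y = 0")
        case True
        thus ?thesis using \<open>x = 0\<close> c by simp
      next
        case False
        then obtain j :: int where j: "v2 y = ereal (of_int j)" by (rule v2_eq_int)
        have "v (to_ac y * \<theta>) = ereal (c * (of_int j + 1 / 2))"
          using ext j t t' by (simp add: algebra_simps)
        thus ?thesis using \<open>x = 0\<close> j by simp
      qed
    next
      assume "y = 0"
      thus ?thesis using ext by simp
    qed
  next
    case False
    then obtain i j :: int where ij: "v2 x = ereal (of_int i)" "v2 y = ereal (of_int j)"
      using v2_eq_int by metis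
    have vx: "v (to_ac x) = ereal (c * of_int i)" using ext ij by simp
    have vy: "v (to_ac y * \<theta>) = ereal (c * (of_int j + 1 / 2))"
      using ext ij t t' by (simp add: algebra_simps)
    have "(of_int i :: real) \<noteq> of_int j + 1 / 2"
    proof
      assume "(of_int i :: real) = of_int j + 1 / 2"
      hence "of_int (2 * i) = (of_int (2 * j + 1) :: real)" by simp
      hence "2 * i = 2 * j + 1" by (simp only: of_int_eq_iff)
      thus False by presburger
    qed
    hence "v (to_ac x) \<noteq> v (to_ac y * \<theta>)" using vx vy c by simp
    hence "v (to_ac x + to_ac y * \<theta>) = min (v (to_ac x)) (v (to_ac y * \<theta>))"
      by (rule valuation_add_neq[OF v])
    also have "\<dots> = ereal (c * min (of_int i) (of_int j + 1 / 2))"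
      unfolding vx vy using c by (auto simp: min_def)
    finally show ?thesis using ij by (simp add: min_def)
  qed
qed

text \<open>Here ties do occur, and the ultrametric inequality alone is not enough. After removing a
  common power of 2 both coordinates are odd, hence so is the norm u^2 - u w + w^2, which forces the
  sum to be a unit.\<close>

lemma gauss_basis_omega:
  assumes root: "\<theta>\<^sup>2 + to_ac 1 * \<theta> + to_ac 1 = 0"
  shows "gauss_basis \<theta> 0"
  unfolding gauss_basis_def
proof (intro allI impI)
  fix v c x y
  assume v: "is_valuation v" and c: "(c :: real) > 0" and ext: "\<forall>x. v (to_ac x) = ereal c * v2 x"
  note [simp] = valuation_mult[OF v] valuation_minus[OF v] valuation_0[OF v]
  have "\<theta> \<noteq> 0" using root by auto
  then obtain t where t: "v \<theta> = ereal t" by (rule valuation_real[OF v])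
  have sq: "\<theta> * \<theta> = - (\<theta> + 1)"
    unfolding eq_neg_iff_add_eq_0 using root by (simp add: power2_eq_square add.assoc)
  have "\<not> t < 0"
  proof
    assume "t < 0"
    have "ereal (2 * t) = v (\<theta> * \<theta>)" using t by simp
    also have "\<dots> = v (\<theta> + 1)" unfolding sq by (rule valuation_minus[OF v])
    also have "\<dots> \<ge> min (v \<theta>) (v 1)" by (rule valuation_add[OF v])
    finally show False
      using t \<open>t < 0\<close> by (auto simp: min_le_iff_disj valuation_1[OF v] zero_ereal_def)
  qed
  moreover have "\<not> t > 0"
  proof
    assume "t > 0"
    have "1 = - (\<theta> * \<theta> + \<theta>)" using sq by simp
    hence "0 = v (\<theta> * \<theta> + \<theta>)" by (metis valuation_minus[OF v] valuation_1[OF v])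
    also have "\<dots> \<ge> min (v (\<theta> * \<theta>)) (v \<theta>)" by (rule valuation_add[OF v])
    finally show False using t \<open>t > 0\<close> by (auto simp: min_le_iff_disj zero_ereal_def)
  qed
  ultimately have t': "v \<theta> = 0" using t by (simp add: zero_ereal_def)
  have vy: "v (to_ac y * \<theta>) = ereal c * v2 y" using ext t' by simp
  have min_scale: "min (ereal c * r) (ereal c * q) = ereal c * min r q" for r q
    using c ereal_mult_left_mono[of r q "ereal c"] ereal_mult_left_mono[of q r "ereal c"]
    by (auto simp: min_def intro: antisym)
  have "v (to_ac x + to_ac y * \<theta>) = ereal c * min (v2 x) (v2 y)"
  proof (cases "v2 x = v2 y")
    case False
    hence "v (to_ac x) \<noteq> v (to_ac y * \<theta>)"
      unfolding vy using ext c by (simp add: ereal_mult_cancel_left)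
    hence "v (to_ac x + to_ac y * \<theta>) = min (v (to_ac x)) (v (to_ac y * \<theta>))"
      by (rule valuation_add_neq[OF v])
    thus ?thesis unfolding vy using ext min_scale by simp
  next
    case eq: True
    show ?thesis
    proof (cases "x = 0")
      case True
      hence "y = 0" using eq by (metis PInfty_neq_ereal(1) v2_0 v2_eq_int)
      thus ?thesis using True c by simp
    next
      case False
      hence y0: "y \<noteq> 0" using eq by (metis PInfty_neq_ereal(1) v2_0 v2_eq_int)
      obtain k u where x: "x = 2 powi k * to_fract u" "u dvd 1"
        using False by (rule two_adic_decomp)
      obtain l w where y: "y = 2 powi l * to_fract w" "w dvd 1"
        using y0 by (rule two_adic_decomp)
      have kl: "l = k" using eq x y by (simp add: v2_decomp)
      define U where "U = to_ac (to_fract u)"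
      define W where "W = to_ac (to_fract w)"
      have vU: "v U = 0" and vW: "v W = 0"
        using ext x(2) y(2) by (auto simp: U_def W_def v2_to_fract_unit)
      have odd: "\<exists>a. u = 1 + 2 * a" if "u dvd 1" for u :: two_adic_int
      proof -
        from that obtain r a where r: "r \<in> {1, 3, 5, 7}" "u = r + 8 * a" by (rule unit_mod_8)
        have "r = 1 + 2 * 0 \<or> r = 1 + 2 * 1 \<or> r = 1 + 2 * 2 \<or> r = 1 + 2 * 3" using r(1) by auto
        then obtain b where "r = 1 + 2 * b" by blast
        hence "u = 1 + 2 * (b + 4 * a)" using r(2) by (simp add: algebra_simps)
        thus ?thesis ..
      qed
      obtain m where m: "u = 1 + 2 * m" using odd[OF x(2)] by blast
      obtain n where n: "w = 1 + 2 * n" using odd[OF y(2)] by blast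
      define N where "N = u * u - u * w + w * w"
      define K where "K = m + 2 * m * m - 2 * m * n + n + 2 * n * n"
      have NK: "N - 2 * K = 1"
        unfolding N_def K_def m n by (simp add: algebra_simps)
      have "\<not> 2 dvd N"
      proof
        assume "2 dvd N"
        hence "2 dvd N - 2 * K" by (rule dvd_diff) simp
        thus False using two_adic_int_unit_iff[of 1] by (simp add: NK)
      qed
      hence "N dvd 1" by (simp add: two_adic_int_unit_iff)
      hence vN: "v (to_ac (to_fract N)) = 0" using ext by (simp add: v2_to_fract_unit)
      \<comment> \<open>The second factor is the conjugate of the first. Both have nonnegative value
        and their product has value 0, so each has value 0.\<close>
      have "(U + W * \<theta>) * (U - W - W * \<theta>) = U * U - U * W - W * W * \<theta> - W * W * (\<theta> * \<theta>)"
        by (simp add: algebra_simps)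
      also have "\<dots> = to_ac (to_fract N)"
        unfolding sq by (simp add: N_def U_def W_def algebra_simps)
      finally have sum: "v (U + W * \<theta>) + v (U - W - W * \<theta>) = 0"
        using vN by (metis valuation_mult[OF v])
      have nonneg: "v (p + q) \<ge> 0" if "v p \<ge> 0" "v q \<ge> 0" for p q
        using valuation_add[OF v, of p q] that by (auto simp: min_def split: if_splits)
      have "v (U + W * \<theta>) \<ge> 0" using vU vW t' by (intro nonneg) auto
      moreover have "v (U + - W + - (W * \<theta>)) \<ge> 0" using vU vW t' by (intro nonneg) auto
      ultimately have "v (U + W * \<theta>) = 0"
        using sum by (cases "v (U + W * \<theta>)"; cases "v (U - W - W * \<theta>)") auto
      moreover have "to_ac x + to_ac y * \<theta> = to_ac (2 powi k) * (U + W * \<theta>)"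
        by (simp add: x y kl U_def W_def algebra_simps)
      ultimately have "v (to_ac x + to_ac y * \<theta>) = ereal c * ereal (of_int k)"
        using ext by (simp add: v2_powi_2)
      moreover have "v2 x = ereal (of_int k)" unfolding x(1) by (rule v2_decomp[OF x(2)])
      hence "min (v2 x) (v2 y) = ereal (of_int k)" using eq by simp
      ultimately show ?thesis by simp
    qed
  qed
  thus "v (to_ac x + to_ac y * \<theta>) = ereal c * min (v2 x) (v2 y + ereal 0)"
    by (simp add: zero_ereal_def[symmetric])
qed

text \<open>If \<open>\<theta>\<close> were the 2-adic number x, the combination x -
  \<open>\<theta>\<close> = 0 would have finite value. As \<open>gauss_basis\<close> quantifies over
  extensions of \<open>v2\<close>, the argument depends on the existence of one.\<close>

lemma gauss_basis_notin_Q2: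
  assumes "gauss_basis \<theta> s"
  shows "\<theta> \<notin> Q2"
proof
  assume "\<theta> \<in> Q2"
  then obtain x where x: "\<theta> = to_ac x" by (auto simp: Q2_def)
  obtain w where w: "is_valuation w" "\<And>x. w (to_ac x) = v2 x" using v2_extension by blast
  have "w (to_ac x + to_ac (- 1) * \<theta>) = ereal 1 * min (v2 x) (v2 (- 1) + ereal s)"
    by (rule gauss_basisD[OF assms w(1)]) (simp_all add: w(2))
  moreover have "w (to_ac x + to_ac (- 1) * \<theta>) = \<infinity>" using x valuation_0[OF w(1)] by simp
  moreover have "v2 (- 1) = 0" by (simp only: v2_uminus v2_1)
  ultimately have "min (v2 x) (ereal s) = \<infinity>"
    by (metis add_0 mult_1 one_ereal_def)
  hence "\<infinity> \<le> ereal s" by (metis min.cobounded2)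
  thus False by simp
qed

section \<open>Valuation, integers and breaks of a quadratic field\<close>

text \<open>\<open>s\<close> is the value of \<open>\<theta>\<close> when 2 has value 1, and
  \<open>e\<close> will be the ramification index. The disjunction treats the unramified field and
  the Eisenstein ones together.\<close>

locale gauss_quadratic =
  fixes \<theta> :: two_adic_closure and a b :: two_adic and s :: real and e :: nat
  assumes quadratic_root: "\<theta>\<^sup>2 + to_ac a * \<theta> + to_ac b = 0"
    and gauss: "gauss_basis \<theta> s"
    and slope: "s = 0 \<and> e = 1 \<or> s = 1 / 2 \<and> e = 2"

sublocale gauss_quadratic \<subseteq> quadratic \<theta> a b
  using quadratic_root gauss_basis_notin_Q2[OF gauss] by unfold_locales

context gauss_quadratic
begin

lemma e_pos: "e > 0"
  using slope by auto

text \<open>The scaling c is left free because it serves twice: with c = e to exhibit a normalized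
  valuation, and with the unknown constant of \<open>val L\<close> to determine that
  constant.\<close>

lemma value_group:
  assumes v: "is_valuation v" and c: "c > 0" and ext: "\<And>x. v (to_ac x) = ereal c * v2 x"
  shows "v ` (L - {0}) = range (\<lambda>k :: int. ereal (c / e * of_int k))"
proof
  have val: "v (to_ac x + to_ac y * \<theta>) = ereal c * min (v2 x) (v2 y + ereal s)" for x y
    by (rule gauss_basisD[OF gauss v c ext])
  show "v ` (L - {0}) \<subseteq> range (\<lambda>k :: int. ereal (c / e * of_int k))"
  proof
    fix r assume "r \<in> v ` (L - {0})"
    then obtain x y where r: "r = v (to_ac x + to_ac y * \<theta>)" and nz: "to_ac x + to_ac y * \<theta> \<noteq> 0"
      by (auto simp: quad_def)
    have y_int: "\<exists>k :: int. v2 y + ereal s = ereal (of_int k / e)" if "y \<noteq> 0"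
    proof -
      from that obtain j :: int where "v2 y = ereal (of_int j)" by (rule v2_eq_int)
      thus ?thesis using slope by (auto intro: exI[of _ j] exI[of _ "2 * j + 1"] simp: add_divide_distrib)
    qed
    have x_int: "\<exists>k :: int. v2 x = ereal (of_int k / e)" if "x \<noteq> 0"
    proof -
      from that obtain i :: int where "v2 x = ereal (of_int i)" by (rule v2_eq_int)
      thus ?thesis using e_pos by (auto intro: exI[of _ "int e * i"])
    qed
    have "x \<noteq> 0 \<or> y \<noteq> 0" using nz by auto
    hence "\<exists>k :: int. min (v2 x) (v2 y + ereal s) = ereal (of_int k / e)"
      using x_int y_int by (cases "x = 0"; cases "y = 0") (auto simp: min_def)
    then obtain k :: int where "min (v2 x) (v2 y + ereal s) = ereal (of_int k / e)" ..
    hence "r = ereal (c / e * of_int k)" using r val by simp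
    thus "r \<in> range (\<lambda>k :: int. ereal (c / e * of_int k))" by blast
  qed
  show "range (\<lambda>k :: int. ereal (c / e * of_int k)) \<subseteq> v ` (L - {0})"
  proof
    fix r assume "r \<in> range (\<lambda>k :: int. ereal (c / e * of_int k))"
    then obtain k :: int where r: "r = ereal (c / e * of_int k)" by blast
    show "r \<in> v ` (L - {0})"
    proof (cases "e = 2 \<and> odd k")
      case True
      then obtain m where k: "k = 2 * m + 1" by (auto elim: oddE)
      define z where "z = to_ac 0 + to_ac (2 powi m) * \<theta>"
      have "v z = ereal c * ereal (of_int m + s)"
        unfolding z_def val by (simp add: v2_powi_2)
      hence "v z = r" using True slope k by (simp add: r field_simps)
      moreover have "z \<noteq> 0"
        using coords_eq_iff[of 0 "2 powi m" 0 0] by (simp add: z_def)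
      moreover have "z \<in> L" unfolding z_def by (rule quadI)
      ultimately show ?thesis by blast
    next
      case False
      then obtain m where m: "k = int e * m" using slope by (auto elim: evenE)
      have "v (to_ac (2 powi m)) = r" using e_pos by (simp add: ext v2_powi_2 r m)
      moreover have "to_ac (2 powi m) \<in> L" using Q2_subset_quad to_ac_in_Q2 by (rule subsetD)
      moreover have "to_ac (2 powi m :: two_adic) \<noteq> 0" by simp
      ultimately show ?thesis by blast
    qed
  qed
qed

lemma normalized_val: "normalized_valuation L (val L)"
proof -
  obtain w where w: "is_valuation w" "\<And>x. w (to_ac x) = v2 x"
    using v2_extension by blast
  define v where "v = (\<lambda>x. ereal (real e) * w x)"
  have v: "is_valuation v" unfolding v_def using e_pos by (intro is_valuation_scale w) simp
  have "v ` (L - {0}) = range (\<lambda>k :: int. ereal (of_int k))"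
    using value_group[of v "real e"] v e_pos w(2) by (simp add: v_def)
  hence "normalized_valuation L v"
    unfolding normalized_valuation_def using v e_pos w(2)
    by (auto simp: v_def intro!: exI[of _ "real e"])
  thus ?thesis unfolding val_def by (rule someI[of "normalized_valuation L"])
qed

lemma is_valuation_val: "is_valuation (val L)"
  using normalized_val by (simp add: normalized_valuation_def)

text \<open>The groups (c/e) Z and Z coincide, so c/e and its inverse are both integers; being
  positive, c/e is 1.\<close>

lemma val_to_ac: "val L (to_ac x) = ereal (real e) * v2 x"
proof -
  obtain c where c: "c > 0" "\<And>x. val L (to_ac x) = ereal c * v2 x"
    using normalized_val by (auto simp: normalized_valuation_def)
  have eq: "range (\<lambda>k :: int. ereal (c / e * of_int k)) = range (\<lambda>k :: int. ereal (of_int k))"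
    using value_group[OF is_valuation_val c] normalized_val by (simp add: normalized_valuation_def)
  have "ereal (of_int 1) \<in> range (\<lambda>k :: int. ereal (c / e * of_int k))" unfolding eq by blast
  then obtain k :: int where "ereal (of_int 1) = ereal (c / e * of_int k)" by blast
  hence k: "c / e * of_int k = 1" by (metis ereal.inject of_int_1)
  have "ereal (c / e * of_int 1) \<in> range (\<lambda>k :: int. ereal (of_int k))"
    unfolding eq[symmetric] by blast
  then obtain m :: int where "ereal (c / e * of_int 1) = ereal (of_int m)" by blast
  hence m: "c / e = of_int m" by (metis ereal.inject of_int_1 mult_1_right)
  have "of_int (m * k) = (of_int 1 :: real)" using k unfolding m by simp
  hence "m * k = 1" by (simp only: of_int_eq_iff)
  moreover have "m > 0" using m c(1) e_pos by (metis of_int_0_less_iff of_nat_0_less_iff zero_less_divide_iff)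
  ultimately have "m = 1" by (simp add: pos_zmult_eq_1_iff)
  hence "c = e" using m e_pos by simp
  thus ?thesis using c(2) by simp
qed

lemma val_quad: "val L (to_ac x + to_ac y * \<theta>) = ereal (real e) * min (v2 x) (v2 y + ereal s)"
  using e_pos by (intro gauss_basisD[OF gauss is_valuation_val] val_to_ac) simp

text \<open>Nonzero y have integral value, so a shift by \<open>s\<close>, which is 0 or 1/2, does
  not change whether the value is nonnegative.\<close>

lemma integers_eq: "integers_of L = {to_ac x + to_ac y * \<theta> | x y. v2 x \<ge> 0 \<and> v2 y \<ge> 0}"
proof -
  have s: "0 \<le> v2 y + ereal s \<longleftrightarrow> 0 \<le> v2 y" for y
  proof (cases "y = 0")
    case False
    then obtain j :: int where j: "v2 y = ereal (of_int j)" by (rule v2_eq_int)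
    have "0 \<le> of_int j + s \<longleftrightarrow> 0 \<le> j" using slope by auto
    thus ?thesis by (simp add: j)
  qed simp
  have "0 \<le> val L (to_ac x + to_ac y * \<theta>) \<longleftrightarrow> 0 \<le> v2 x \<and> 0 \<le> v2 y" for x y
  proof -
    have "0 \<le> ereal (real e) * r \<longleftrightarrow> 0 \<le> r" for r
      using e_pos by (cases r) (auto simp: zero_le_mult_iff)
    thus ?thesis unfolding val_quad by (simp add: s)
  qed
  thus ?thesis by (auto simp: integers_of_def quad_def)
qed

lemma ramification_index_eq: "ramification_index L Q2 = e"
proof -
  have img: "val L ` (Q2 - {0}) = range (\<lambda>k :: int. ereal (of_int (int e * k)))"
  proof
    show "val L ` (Q2 - {0}) \<subseteq> range (\<lambda>k :: int. ereal (of_int (int e * k)))"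
    proof
      fix r assume "r \<in> val L ` (Q2 - {0})"
      then obtain z where z: "z \<in> Q2" "z \<noteq> 0" "r = val L z" by blast
      from z(1) obtain x where "z = to_ac x" by (auto simp: Q2_def)
      hence x: "x \<noteq> 0" "r = val L (to_ac x)" using z by simp_all
      obtain k :: int where "v2 x = ereal (of_int k)" using x(1) by (rule v2_eq_int)
      hence "r = ereal (of_int (int e * k))" using x(2) by (simp add: val_to_ac)
      thus "r \<in> range (\<lambda>k :: int. ereal (of_int (int e * k)))" by blast
    qed
    show "range (\<lambda>k :: int. ereal (of_int (int e * k))) \<subseteq> val L ` (Q2 - {0})"
    proof
      fix r assume "r \<in> range (\<lambda>k :: int. ereal (of_int (int e * k)))"
      then obtain k :: int where "r = ereal (of_int (int e * k))" by blast
      hence "r = val L (to_ac (2 powi k))" by (simp add: val_to_ac v2_powi_2)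
      moreover have "to_ac (2 powi k) \<in> Q2 - {0}" by simp
      ultimately show "r \<in> val L ` (Q2 - {0})" by (rule image_eqI)
    qed
  qed
  show ?thesis
    unfolding ramification_index_def
  proof (rule the_equality)
    show "val L ` (Q2 - {0}) = range (\<lambda>k :: int. ereal (of_int (int e * k)))" by (rule img)
    fix e' assume "val L ` (Q2 - {0}) = range (\<lambda>k :: int. ereal (of_int (int e' * k)))"
    hence eq: "range (\<lambda>k :: int. ereal (of_int (int e * k))) = range (\<lambda>k :: int. ereal (of_int (int e' * k)))"
      using img by simp
    have dvd: "int m dvd int n"
      if "range (\<lambda>k :: int. ereal (of_int (int m * k))) = range (\<lambda>k :: int. ereal (of_int (int n * k)))" for m n :: nat
    proof -
      have "ereal (of_int (int n * 1)) \<in> range (\<lambda>k :: int. ereal (of_int (int m * k)))"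
        unfolding that by blast
      then obtain k :: int where "ereal (of_int (int n * 1)) = ereal (of_int (int m * k))" by blast
      hence "int n * 1 = int m * k" by (simp only: ereal.inject of_int_eq_iff)
      thus ?thesis by simp
    qed
    show "e' = e" using dvd[OF eq] dvd[OF eq[symmetric]] by (simp add: dvd_antisym)
  qed
qed

lemma val_conj_diff:
  fixes d :: real
  assumes "v2 (a\<^sup>2 - 4 * b) = ereal d"
  shows "val L (\<theta>' - \<theta>) = ereal (e * d / 2)"
proof -
  have "(\<theta>' - \<theta>) * (\<theta>' - \<theta>) = to_ac a * to_ac a + 4 * (to_ac a * \<theta>) + 4 * (\<theta> * \<theta>)"
    by (simp add: algebra_simps)
  also have "\<dots> = to_ac (a\<^sup>2 - 4 * b)"
    unfolding sq by (simp add: algebra_simps power2_eq_square)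
  finally have sq_diff: "(\<theta>' - \<theta>) * (\<theta>' - \<theta>) = to_ac (a\<^sup>2 - 4 * b)" .
  have "val L (\<theta>' - \<theta>) + val L (\<theta>' - \<theta>) = val L (to_ac (a\<^sup>2 - 4 * b))"
    unfolding sq_diff[symmetric] by (rule valuation_mult[OF is_valuation_val, symmetric])
  also have "\<dots> = ereal (e * d)" unfolding val_to_ac assms by simp
  finally show ?thesis by (cases "val L (\<theta>' - \<theta>)") auto
qed

lemma ram_number_id: "ram_number L (restrict id L) = \<infinity>"
proof -
  have "\<infinity> \<le> ram_number L (restrict id L)"
    unfolding ram_number_def
  proof (rule INF_greatest)
    fix z assume "z \<in> integers_of L"
    hence "z \<in> L" unfolding integers_of_def by blast
    hence "restrict id L z - z = 0" by simp
    thus "\<infinity> \<le> val L (restrict id L z - z)"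
      by (simp only: valuation_0[OF is_valuation_val] order_refl)
  qed
  thus ?thesis by simp
qed

text \<open>Conjugation moves z by y (\<open>\<theta>'\<close> - \<open>\<theta>\<close>), where y
  is the integral second coordinate of z; the infimum is attained at
  \<open>\<theta>\<close>.\<close>

lemma ram_number_conj: "ram_number L conj = val L (\<theta>' - \<theta>)"
  unfolding ram_number_def
proof (rule antisym)
  have "to_ac 0 + to_ac 1 * \<theta> \<in> integers_of L"
    unfolding integers_eq by (intro CollectI exI[of _ 0] exI[of _ 1]) simp
  hence "\<theta> \<in> integers_of L" by simp
  thus "(INF z\<in>integers_of L. val L (conj z - z)) \<le> val L (\<theta>' - \<theta>)"
    by (rule INF_lower2) (simp add: conj_theta)
  show "val L (\<theta>' - \<theta>) \<le> (INF z\<in>integers_of L. val L (conj z - z))"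
  proof (rule INF_greatest)
    fix z assume "z \<in> integers_of L"
    then obtain x y where z: "z = to_ac x + to_ac y * \<theta>" and y: "v2 y \<ge> 0"
      by (auto simp: integers_eq)
    have "conj z - z = to_ac y * (\<theta>' - \<theta>)" unfolding z conj_eq by (simp add: algebra_simps)
    hence "val L (conj z - z) = ereal (real e) * v2 y + val L (\<theta>' - \<theta>)"
      by (simp only: valuation_mult[OF is_valuation_val] val_to_ac)
    moreover have "0 \<le> ereal (real e) * v2 y" using y by (simp add: zero_le_mult_iff)
    ultimately show "val L (\<theta>' - \<theta>) \<le> val L (conj z - z)"
      by (metis add_increasing order_refl)
  qed
qed

lemma conj_neq_id: "conj \<noteq> restrict id L"
proof
  assume "conj = restrict id L"
  hence "conj \<theta> = \<theta>" using quad_self by simp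
  thus False using theta'_neq by (simp only: conj_theta)
qed

text \<open>The only lower break is \<open>r - 1\<close>; the Herbrand function has slope 1 up to it and slope \<open>1/e\<close>
  afterwards.\<close>

context
  fixes r :: real
  assumes r: "val L (\<theta>' - \<theta>) = ereal r" and r_e: "e = 1 \<and> r = 0 \<or> e = 2 \<and> r \<ge> 1"
begin

lemma lower_ram_eq: "lower_ram L Q2 m = (if m \<le> r - 1 then {restrict id L, conj} else {restrict id L})"
proof -
  have "ram_number L conj = ereal r" by (simp only: ram_number_conj r)
  hence c: "ereal (m + 1) \<le> ram_number L conj \<longleftrightarrow> m \<le> r - 1" by (simp add: le_diff_eq)
  have i: "ereal (m + 1) \<le> ram_number L (restrict id L)" unfolding ram_number_id by simp
  have "lower_ram L Q2 m = {\<sigma> \<in> {restrict id L, conj}. ereal (m + 1) \<le> ram_number L \<sigma>}"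
    unfolding lower_ram_def embeddings_eq ..
  also have "\<dots> = {restrict id L} \<union> {\<sigma> \<in> {conj}. m \<le> r - 1}" using c i by blast
  finally show ?thesis by (cases "m \<le> r - 1") (simp_all add: insert_commute)
qed

lemma card_lower_ram: "real (card (lower_ram L Q2 m)) = (if m \<le> r - 1 then 2 else 1)"
proof -
  have "restrict id L \<noteq> conj" using conj_neq_id by metis
  thus ?thesis by (simp only: lower_ram_eq split: if_split) simp
qed

lemma integral_card:
  assumes "m > 0"
  shows "integral {0..m} (\<lambda>y. real (card (lower_ram L Q2 y))) =
    (if r \<ge> 1 then (if m \<le> r - 1 then 2 * m else 2 * (r - 1) + (m - (r - 1))) else m)"
proof -
  define f :: "real \<Rightarrow> real" where "f = (\<lambda>y. if y \<le> r - 1 then 2 else 1)"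
  have low: "(f has_integral 2 * u) {0..u}" if "0 \<le> u" "u \<le> r - 1" for u
  proof (rule has_integral_eq[where f = "\<lambda>_. 2"])
    show "((\<lambda>_. 2 :: real) has_integral 2 * u) {0..u}"
      using has_integral_const_real[of "2 :: real" 0 u] that by (simp add: mult.commute)
  qed (use that in \<open>auto simp: f_def\<close>)
  \<comment> \<open>If u = r - 1, the integrand is still 2 at the left end point; a single point
    does not affect the integral.\<close>
  have high: "(f has_integral m - u) {u..m}" if "r - 1 \<le> u" "u \<le> m" for u
  proof (rule has_integral_spike_finite[where S = "{r - 1}" and f = "\<lambda>_. 1"])
    show "((\<lambda>_. 1 :: real) has_integral m - u) {u..m}"
      using has_integral_const_real[of "1 :: real" u m] that by simp
  qed (use that in \<open>auto simp: f_def\<close>)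
  have "(f has_integral (if r \<ge> 1 then (if m \<le> r - 1 then 2 * m else 2 * (r - 1) + (m - (r - 1))) else m)) {0..m}"
  proof (cases "r \<ge> 1 \<and> m > r - 1")
    case True
    hence "(f has_integral 2 * (r - 1) + (m - (r - 1))) {0..m}"
      by (intro has_integral_combine[of 0 "r - 1" m] low high) auto
    thus ?thesis using True by simp
  next
    case False
    thus ?thesis using assms low[of m] high[of 0] r_e by auto
  qed
  thus ?thesis unfolding card_lower_ram f_def by (rule integral_unique)
qed

text \<open>For e = 2 the factor 1/e cancels the two embeddings below the break. For e = 1 the break
  is at -1 and the second formula is also the identity, so one closed form covers both cases and the
  range m <= 0.\<close>

lemma herbrand_phi_eq:
  "herbrand_phi L Q2 m = (if m \<le> r - 1 then m else r - 1 + (m - (r - 1)) / e)"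
proof (cases "m > 0")
  case True
  thus ?thesis
    using r_e unfolding herbrand_phi_def ramification_index_eq
    by (auto simp: integral_card field_simps)
next
  case False
  thus ?thesis using r_e by (auto simp: herbrand_phi_def)
qed

lemma herbrand_psi_eq:
  assumes "t \<ge> -1"
  shows "herbrand_psi L Q2 t = (if t \<le> r - 1 then t else r - 1 + e * (t - (r - 1)))"
  unfolding herbrand_psi_def
proof (rule the_inv_into_f_eq)
  show "inj_on (herbrand_phi L Q2) {-1..}"
    using r_e by (auto intro!: inj_onI simp: herbrand_phi_eq split: if_splits)
qed (use r_e assms in \<open>auto simp: herbrand_phi_eq\<close>)

lemma max_upper_break_eq: "max_upper_break L Q2 = r"
proof -
  have r0: "r \<ge> 0" using r_e by auto
  have iff: "shifted_upper_ram L Q2 m \<noteq> {restrict id L} \<longleftrightarrow> m \<le> r" if "m \<ge> 0" for m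
  proof -
    have "herbrand_psi L Q2 (m - 1) \<le> r - 1 \<longleftrightarrow> m \<le> r"
      using that r_e by (auto simp: herbrand_psi_eq)
    moreover have "{restrict id L, conj} \<noteq> {restrict id L}" using conj_neq_id by blast
    ultimately show ?thesis
      by (simp add: shifted_upper_ram_def upper_ram_def lower_ram_eq)
  qed
  \<comment> \<open>The Herbrand function fixes the lower break r - 1, so the upper break is r - 1
    as well, and the shifted numbering adds one. In the unramified case r = 0 only m = 0 remains,
    which still gives the supremum 0.\<close>
  have "{m. m \<ge> 0 \<and> shifted_upper_ram L Q2 m \<noteq> {restrict id L}} = {0..r}"
  proof (rule Set.set_eqI)
    fix m
    show "m \<in> {m. m \<ge> 0 \<and> shifted_upper_ram L Q2 m \<noteq> {restrict id L}} \<longleftrightarrow> m \<in> {0..r}"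
      unfolding mem_Collect_eq atLeastAtMost_iff using iff[of m] by blast
  qed
  thus ?thesis using L_neq_Q2 r0 by (simp add: max_upper_break_def)
qed

end

end

section \<open>The quadratic extensions of the 2-adic numbers\<close>

text \<open>A primitive cube root of unity; it generates the unramified quadratic extension.\<close>

definition omega :: two_adic_closure where
  "omega = (SOME x. x\<^sup>2 + x + 1 = 0)"

lemma quadratic_root_exists: "\<exists>x. x\<^sup>2 + p * x + q = (0 :: 'a :: alg_closed_field)"
proof -
  have "\<exists>x. poly [:q, p, 1:] x = 0" by (rule alg_closed_imp_poly_has_root) simp
  thus ?thesis by (auto simp: algebra_simps power2_eq_square)
qed

lemma omega_root: "omega\<^sup>2 + omega + 1 = 0"
  unfolding omega_def by (rule someI_ex) (use quadratic_root_exists[of 1 1] in simp)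

interpretation omega: gauss_quadratic omega 1 1 0 1
proof
  show root: "omega\<^sup>2 + to_ac 1 * omega + to_ac 1 = 0" using omega_root by simp
  show "gauss_basis omega 0" using root by (rule gauss_basis_omega)
qed simp

lemma v2_odd: "v2 (to_fract (1 + 2 * a)) = 0"
proof (rule v2_to_fract_unit)
  have "\<not> 2 dvd 1 + 2 * a"
  proof
    assume "2 dvd 1 + 2 * a"
    hence "2 dvd (1 + 2 * a) - 2 * a" by (rule dvd_diff) simp
    thus False using two_adic_int_unit_iff[of 1] by simp
  qed
  thus "1 + 2 * a dvd 1" by (simp add: two_adic_int_unit_iff)
qed

lemma v2_numerals:
  "v2 3 = 0" "v2 5 = 0" "v2 4 = 2" "v2 6 = 1" "v2 10 = 1" "v2 8 = 3" "v2 20 = 2" "v2 24 = 3" "v2 40 = 3"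
proof -
  show 3: "v2 3 = 0" using v2_odd[of 1] by simp
  show 5: "v2 5 = 0" using v2_odd[of 2] by simp
  show 4: "v2 4 = 2" using v2_mult[of 2 2] by (simp add: one_ereal_def)
  show 6: "v2 6 = 1" using v2_mult[of 2 3] 3 by simp
  show 10: "v2 10 = 1" using v2_mult[of 2 5] 5 by simp
  show 8: "v2 8 = 3" using v2_mult[of 2 4] 4 by (simp add: one_ereal_def)
  show "v2 20 = 2" using v2_mult[of 4 5] 4 5 by simp
  show "v2 24 = 3" using v2_mult[of 8 3] 8 3 by simp
  show "v2 40 = 3" using v2_mult[of 8 5] 8 5 by simp
qed

lemma max_upper_break_omega: "max_upper_break (quad omega) Q2 = 0"
proof (rule omega.max_upper_break_eq)
  show "val (quad omega) (- to_ac 1 - omega - omega) = ereal 0"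
    using omega.val_conj_diff[of 0] v2_uminus[of 3] by (simp add: v2_numerals zero_ereal_def)
qed simp

definition eisenstein_root :: "nat \<Rightarrow> two_adic_closure" where
  "eisenstein_root i = (SOME x. poly (map_poly to_ac (ramified_poly i)) x = 0)"

lemma ramified_quadratic_eq: "ramified_quadratic i = adjoin_Q2 {eisenstein_root i}"
  by (simp add: ramified_quadratic_def eisenstein_root_def)

text \<open>The break equals the value d of the discriminant because the factor e = 2 cancels the
  halving caused by the square root. D is a quarter of the discriminant, so \<open>\<theta>\<close>
  + a/2 is a square root of D.\<close>

lemma eisenstein_case:
  assumes p: "ramified_poly i = [:b, a, 1:]" and a: "v2 a \<ge> 1" and b: "v2 b = 1"
    and d: "v2 (a\<^sup>2 - 4 * b) = ereal d" "d \<ge> 1"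
    and D: "a\<^sup>2 - 4 * b = 4 * D"
  shows "ramification_index (ramified_quadratic i) Q2 = 2"
    "max_upper_break (ramified_quadratic i) Q2 = d"
    "x\<^sup>2 = to_ac D \<Longrightarrow> adjoin_Q2 {x} = ramified_quadratic i"
proof -
  define \<theta> where "\<theta> = eisenstein_root i"
  have "poly (map_poly to_ac (ramified_poly i)) \<theta> = 0"
    unfolding \<theta>_def eisenstein_root_def
  proof (rule someI_ex)
    show "\<exists>x. poly (map_poly to_ac (ramified_poly i)) x = 0"
      by (rule alg_closed_imp_poly_has_root) (simp add: p map_poly_pCons)
  qed
  hence root: "\<theta>\<^sup>2 + to_ac a * \<theta> + to_ac b = 0"
    by (simp add: p map_poly_pCons algebra_simps power2_eq_square)
  interpret gauss_quadratic \<theta> a b "1 / 2" 2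
    using root gauss_basis_eisenstein[OF root a b] by unfold_locales auto
  have L: "ramified_quadratic i = L"
    by (simp add: ramified_quadratic_eq \<theta>_def[symmetric] adjoin_eq_quad)
  show "ramification_index (ramified_quadratic i) Q2 = 2"
    unfolding L by (rule ramification_index_eq)
  show "max_upper_break (ramified_quadratic i) Q2 = d"
    unfolding L
  proof (rule max_upper_break_eq)
    show "val L (\<theta>' - \<theta>) = ereal d" using val_conj_diff[OF d(1)] by simp
  qed (use d(2) in simp)
  show "adjoin_Q2 {x} = ramified_quadratic i" if x: "x\<^sup>2 = to_ac D"
  proof -
    define y where "y = to_ac (a / 2) + to_ac 1 * \<theta>"
    have "2 * y = to_ac a + 2 * \<theta>" by (simp add: y_def distrib_left)
    moreover have "4 * y\<^sup>2 = (2 * y)\<^sup>2" by (simp add: power_mult_distrib)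
    ultimately have "4 * y\<^sup>2 = (to_ac a + 2 * \<theta>)\<^sup>2" by simp
    also have "\<dots> = 4 * (\<theta>\<^sup>2 + to_ac a * \<theta> + to_ac b) + to_ac (a\<^sup>2 - 4 * b)"
      by (simp add: power2_eq_square algebra_simps)
    also have "\<dots> = 4 * to_ac D" unfolding root D by simp
    finally have "x\<^sup>2 = to_ac 1 ^ 2 * y\<^sup>2" using x by simp
    hence "adjoin_Q2 {x} = adjoin_Q2 {y}" by (rule adjoin_Q2_sqrt_eq) simp
    also have "\<dots> = adjoin_Q2 {\<theta>}" unfolding y_def by (rule adjoin_Q2_affine) simp
    finally show ?thesis by (simp add: ramified_quadratic_eq \<theta>_def)
  qed
qed

text \<open>The discriminants are -4, -20 with value 2 and -8, -40, 8, -24 with value 3. The list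
  contains their quarters.\<close>

lemma ramified_quadratic_properties:
  assumes "i \<in> {1..6}"
  shows "ramification_index (ramified_quadratic i) Q2 = 2"
    and "max_upper_break (ramified_quadratic i) Q2 \<in> {2, 3}"
    and "x\<^sup>2 = to_ac ([-1, -5, -2, -10, 2, -6] ! (i - 1)) \<Longrightarrow> adjoin_Q2 {x} = ramified_quadratic i"
proof -
  have "i = 1 \<or> i = 2 \<or> i = 3 \<or> i = 4 \<or> i = 5 \<or> i = 6" using assms by auto
  hence "ramification_index (ramified_quadratic i) Q2 = 2 \<and>
    max_upper_break (ramified_quadratic i) Q2 \<in> {2, 3} \<and>
    (x\<^sup>2 = to_ac ([-1, -5, -2, -10, 2, -6] ! (i - 1)) \<longrightarrow> adjoin_Q2 {x} = ramified_quadratic i)"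
  proof (elim disjE)
    assume i: "i = 1"
    have *: "v2 (2\<^sup>2 - 4 * 2) = ereal 2" using v2_uminus[of 4] by (simp add: v2_numerals)
    note c = eisenstein_case[of i 2 2 2 "-1", OF _ _ _ *]
    show ?thesis using c(1,2) c(3)[of x] by (simp add: i ramified_poly_def)
  next
    assume i: "i = 2"
    have *: "v2 (2\<^sup>2 - 4 * 6) = ereal 2" using v2_uminus[of 20] by (simp add: v2_numerals)
    note c = eisenstein_case[of i 6 2 2 "-5", OF _ _ _ *]
    show ?thesis using c(1,2) c(3)[of x] by (simp add: i ramified_poly_def v2_numerals)
  next
    assume i: "i = 3"
    have *: "v2 (0\<^sup>2 - 4 * 2) = ereal 3" using v2_uminus[of 8] by (simp add: v2_numerals)
    note c = eisenstein_case[of i 2 0 3 "-2", OF _ _ _ *]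
    show ?thesis using c(1,2) c(3)[of x] by (simp add: i ramified_poly_def v2_numerals)
  next
    assume i: "i = 4"
    have *: "v2 (0\<^sup>2 - 4 * 10) = ereal 3" using v2_uminus[of 40] by (simp add: v2_numerals)
    note c = eisenstein_case[of i 10 0 3 "-10", OF _ _ _ *]
    show ?thesis using c(1,2) c(3)[of x] by (simp add: i ramified_poly_def v2_numerals)
  next
    assume i: "i = 5"
    have *: "v2 (4\<^sup>2 - 4 * 2) = ereal 3" by (simp add: v2_numerals)
    note c = eisenstein_case[of i 2 4 3 "2", OF _ _ _ *]
    show ?thesis using c(1,2) c(3)[of x] by (simp add: i ramified_poly_def v2_numerals)
  next
    assume i: "i = 6"
    have *: "v2 (4\<^sup>2 - 4 * 10) = ereal 3" using v2_uminus[of 24] by (simp add: v2_numerals)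
    note c = eisenstein_case[of i 10 4 3 "-6", OF _ _ _ *]
    show ?thesis using c(1,2) c(3)[of x] by (simp add: i ramified_poly_def v2_numerals)
  qed
  thus "ramification_index (ramified_quadratic i) Q2 = 2"
    and "max_upper_break (ramified_quadratic i) Q2 \<in> {2, 3}"
    and "x\<^sup>2 = to_ac ([-1, -5, -2, -10, 2, -6] ! (i - 1)) \<Longrightarrow> adjoin_Q2 {x} = ramified_quadratic i"
    by blast+
qed

lemma adjoin_sqrt_cases:
  assumes "x\<^sup>2 = to_ac d"
  shows "adjoin_Q2 {x} = Q2 \<or> adjoin_Q2 {x} = quad omega \<or>
    (\<exists>i\<in>{1..6}. adjoin_Q2 {x} = ramified_quadratic i)"
proof (cases "d = 0")
  case True
  hence "x = to_ac 0" using assms by simp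
  thus ?thesis by (metis adjoin_Q2_eq_Q2 empty_subsetI insert_subset to_ac_in_Q2)
next
  case False
  then obtain e c where e: "e \<in> {1, -3, -1, -5, -2, -10, 2, -6}" and c: "c \<noteq> 0" and d: "d = e * c\<^sup>2"
    by (rule square_class)
  define y where "y = x / to_ac c"
  have y: "y\<^sup>2 = to_ac e" using assms c by (simp add: y_def d power_divide)
  have "x = to_ac 0 + to_ac c * y" using c by (simp add: y_def)
  hence xy: "adjoin_Q2 {x} = adjoin_Q2 {y}" using adjoin_Q2_affine[OF c, of 0 y] by simp
  have ram: "\<exists>i\<in>{1..6}. adjoin_Q2 {y} = ramified_quadratic i"
    if "i \<in> {1..6}" "e = [-1, -5, -2, -10, 2, -6] ! (i - 1)" for i
    using that ramified_quadratic_properties(3)[OF that(1), of y] y by auto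
  consider "e = 1" | "e = -3" | "e = -1" | "e = -5" | "e = -2" | "e = -10" | "e = 2" | "e = -6"
    using e by blast
  hence "adjoin_Q2 {y} = Q2 \<or> adjoin_Q2 {y} = quad omega \<or>
    (\<exists>i\<in>{1..6}. adjoin_Q2 {y} = ramified_quadratic i)"
  proof cases
    case 1
    hence "y = to_ac 1 \<or> y = to_ac (- 1)" using y by (simp add: power2_eq_1_iff)
    hence "{y} \<subseteq> Q2" by (auto simp del: to_ac_1 to_ac_minus)
    thus ?thesis by (simp add: adjoin_Q2_eq_Q2)
  next
    case 2
    \<comment> \<open>1 + 2 \<open>omega\<close> is a square root of -3.\<close>
    define z where "z = to_ac 1 + to_ac 2 * omega"
    have "z\<^sup>2 = 4 * (omega\<^sup>2 + omega + 1) - 3"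
      by (simp add: z_def power2_eq_square algebra_simps)
    hence "y\<^sup>2 = to_ac 1 ^ 2 * z\<^sup>2" using y 2 by (simp add: omega_root)
    hence "adjoin_Q2 {y} = adjoin_Q2 {z}" by (rule adjoin_Q2_sqrt_eq) simp
    also have "\<dots> = adjoin_Q2 {omega}" unfolding z_def by (rule adjoin_Q2_affine) simp
    finally show ?thesis by (simp add: omega.adjoin_eq_quad)
  qed (use ram[of 1] ram[of 2] ram[of 3] ram[of 4] ram[of 5] ram[of 6] in simp_all)
  thus ?thesis by (simp only: xy)
qed

section \<open>Uniqueness of the unramified quadratic extension\<close>

text \<open>Two line extensions give a spanning pair v, w. Writing 1 as a combination of them
  eliminates one of the two in favour of 1, so F has the form Q2 + Q2 \<open>\<theta>\<close>;
  completing the square in the equation of \<open>\<theta>\<close> gives x.\<close>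

lemma dimension_2_imp_adjoin_sqrt:
  assumes sub: "subfield F closure_ring" and dim: "ring.dimension closure_ring 2 Q2 F"
  obtains x d where "x\<^sup>2 = to_ac d" "F = adjoin_Q2 {x}"
proof -
  interpret field closure_ring by (rule field_from_type_algebra)
  note Q = subfield_closure_ringD[OF subfield_Q2]
  note S = subfield_closure_ringD[OF sub]
  obtain v E where F: "F = line_extension Q2 v E" and E: "dimension 1 Q2 E"
    using dim by (cases rule: dimension.cases) auto
  obtain w Z where EZ: "E = line_extension Q2 w Z" and Z: "dimension 0 Q2 Z"
    using E by (cases rule: dimension.cases) auto
  have "Z = {0}" using Z by (cases rule: dimension.cases) auto
  hence E_eq: "E = (\<lambda>k. k * w) ` Q2"
    using EZ by (auto simp: line_extension_mem_iff image_iff)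
  have F_iff: "z \<in> F \<longleftrightarrow> (\<exists>k\<in>Q2. \<exists>l\<in>Q2. z = k * v + l * w)" for z
    unfolding F line_extension_mem_iff E_eq by simp
  have span: "F \<subseteq> quad \<theta>" if "v \<in> quad \<theta>" "w \<in> quad \<theta>" for \<theta>
  proof
    fix z assume "z \<in> F"
    then obtain k l where kl: "z = to_ac k * v + to_ac l * w" by (auto simp: F_iff Q2_def)
    from that obtain p q p' q' where "v = to_ac p + to_ac q * \<theta>" "w = to_ac p' + to_ac q' * \<theta>"
      by (auto simp: quad_def)
    hence "z = to_ac (k * p + l * p') + to_ac (k * q + l * q') * \<theta>"
      by (simp add: kl algebra_simps)
    thus "z \<in> quad \<theta>" using quadI by metis
  qed
  obtain k l where kl: "1 = to_ac k * v + to_ac l * w"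
    using S(2) by (auto simp: F_iff Q2_def)
  have vw: "v \<in> F" "w \<in> F"
    using F_iff Q(1,2) by (metis add.right_neutral mult_1 mult_zero_left add_0)+
  have "\<exists>\<theta>\<in>F. F \<subseteq> quad \<theta>"
  proof (cases "k = 0")
    case False
    hence "v = to_ac (1 / k) + to_ac (- l / k) * w" using kl by (simp add: field_simps)
    hence "F \<subseteq> quad w" using quadI quad_self by (intro span) metis+
    thus ?thesis using vw by blast
  next
    case True
    hence "l \<noteq> 0" using kl by auto
    hence "w = to_ac (1 / l) + to_ac 0 * v" using kl True by (simp add: field_simps)
    hence "F \<subseteq> quad v" using quadI quad_self by (intro span) metis+
    thus ?thesis using vw by blast
  qed
  then obtain \<theta> where \<theta>: "\<theta> \<in> F" "F \<subseteq> quad \<theta>" by blast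
  have Q2F: "Q2 \<subseteq> F"
  proof
    fix z assume z: "z \<in> Q2"
    obtain k' l' where "1 = k' * v + l' * w" "k' \<in> Q2" "l' \<in> Q2" using S(2) F_iff by blast
    hence "z = z * (k' * v + l' * w)" by simp
    hence "z = (z * k') * v + (z * l') * w" by (simp only: distrib_left mult.assoc)
    thus "z \<in> F" unfolding F_iff using z Q(5) \<open>k' \<in> Q2\<close> \<open>l' \<in> Q2\<close> by blast
  qed
  have "\<theta> * \<theta> \<in> quad \<theta>" using S(5) \<theta> by blast
  then obtain p q where pq: "\<theta> * \<theta> = to_ac p + to_ac q * \<theta>" by (auto simp: quad_def)
  define x where "x = to_ac (- q / 2) + to_ac 1 * \<theta>"
  have "x\<^sup>2 = \<theta> * \<theta> - to_ac q * \<theta> + to_ac (q\<^sup>2 / 4)"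
    by (simp add: x_def power2_eq_square algebra_simps)
  also have "\<dots> = to_ac (p + q\<^sup>2 / 4)" unfolding pq by simp
  finally have "x\<^sup>2 = to_ac (p + q\<^sup>2 / 4)" .
  moreover have "F = adjoin_Q2 {x}"
  proof -
    have "adjoin_Q2 {x} = adjoin_Q2 {\<theta>}" unfolding x_def by (rule adjoin_Q2_affine) simp
    moreover have "adjoin_Q2 {\<theta>} \<subseteq> F" using adjoin_Q2_subset[OF sub Q2F] \<theta> by simp
    moreover have "quad \<theta> \<subseteq> adjoin_Q2 {\<theta>}"
      using subfield_closure_ringD(3,5)[OF subfield_adjoin_Q2[of "{\<theta>}"]] adjoin_Q2_incl[of "{\<theta>}"]
      by (auto simp: quad_def subset_iff)
    ultimately show ?thesis using \<theta>(2) by blast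
  qed
  ultimately show ?thesis by (rule that)
qed

lemma dimension_2_neq_Q2: "\<not> ring.dimension closure_ring 2 Q2 Q2"
proof
  interpret field closure_ring by (rule field_from_type_algebra)
  assume "dimension 2 Q2 Q2"
  moreover have "dimension 1 Q2 Q2"
  proof -
    have "line_extension Q2 1 {0} = Q2" by (auto simp: line_extension_mem_iff)
    thus ?thesis using Suc_dim[of 1 "{0}" 0 Q2] zero_dim[of Q2] by simp
  qed
  ultimately show False using dimension_is_inj[OF subfield_Q2] by fastforce
qed

lemma Q4_eq: "Q4 = quad omega"
  unfolding Q4_def
proof (rule the_equality)
  show "subfield (quad omega) closure_ring \<and> Q2 \<subseteq> quad omega \<and>
      ring.dimension closure_ring 2 Q2 (quad omega) \<and> ramification_index (quad omega) Q2 = 1"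
    using omega.subfield_L Q2_subset_quad omega.dimension_L omega.ramification_index_eq by simp
  fix F
  assume F: "subfield F closure_ring \<and> Q2 \<subseteq> F \<and>
      ring.dimension closure_ring 2 Q2 F \<and> ramification_index F Q2 = 1"
  then obtain x d where "x\<^sup>2 = to_ac d" "F = adjoin_Q2 {x}"
    using dimension_2_imp_adjoin_sqrt by blast
  hence "F = Q2 \<or> F = quad omega \<or> (\<exists>i\<in>{1..6}. F = ramified_quadratic i)"
    using adjoin_sqrt_cases by blast
  moreover have "F \<noteq> Q2" using F dimension_2_neq_Q2 by blast
  moreover have "F \<noteq> ramified_quadratic i" if "i \<in> {1..6}" for i
    using ramified_quadratic_properties(1)[OF that] F by auto
  ultimately show "F = quad omega" by blast
qed

section \<open>The 2-torsion of an elliptic curve\<close>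

definition c6 :: "'a :: field weierstrass \<Rightarrow> 'a" where
  "c6 E = - (b\<^sub>2 E ^ 3) + 36 * b\<^sub>2 E * b\<^sub>4 E - 216 * b\<^sub>6 E"

text \<open>On the curve this is the square of \<open>2 * y + a\<^sub>1 E * x + a\<^sub>3 E\<close>,
  written as a polynomial in x.\<close>

definition two_torsion_cubic :: "'a :: field weierstrass \<Rightarrow> 'a \<Rightarrow> 'a" where
  "two_torsion_cubic E x = 4 * x ^ 3 + b\<^sub>2 E * x\<^sup>2 + 2 * b\<^sub>4 E * x + b\<^sub>6 E"

lemma b8_relation: "4 * b\<^sub>8 E = b\<^sub>2 E * b\<^sub>6 E - b\<^sub>4 E ^ 2"
  unfolding b\<^sub>2_def b\<^sub>4_def b\<^sub>6_def b\<^sub>8_def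
  by (simp add: algebra_simps power2_eq_square)

lemma c4_c6_discriminant: "1728 * discriminant E = c\<^sub>4 E ^ 3 - c6 E ^ 2"
proof -
  \<comment> \<open>A factor 4 of 1728 = 432 * 4 is kept next to \<open>b\<^sub>8\<close>, so that
    \<open>b8_relation\<close> eliminates it without a division.\<close>
  have "1728 * discriminant E = - (432 * b\<^sub>2 E ^ 2 * (4 * b\<^sub>8 E)) - 13824 * b\<^sub>4 E ^ 3
      - 46656 * b\<^sub>6 E ^ 2 + 15552 * b\<^sub>2 E * b\<^sub>4 E * b\<^sub>6 E"
    by (simp add: discriminant_def algebra_simps)
  thus ?thesis
    unfolding b8_relation c\<^sub>4_def c6_def
    by (simp add: algebra_simps power2_eq_square power3_eq_cube)
qed

text \<open>The substitution X = 36 x + 3 \<open>b\<^sub>2 E\<close> removes the quadratic term and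
  leads to the short form X^3 - 27 \<open>c\<^sub>4 E\<close> X - 54 \<open>c6 E\<close>. The factor
  is 11664 = 36^3 / 4.\<close>

lemma two_torsion_cubic_depressed:
  "11664 * two_torsion_cubic E x =
    (36 * x + 3 * b\<^sub>2 E) ^ 3 - 27 * c\<^sub>4 E * (36 * x + 3 * b\<^sub>2 E) - 54 * c6 E"
  unfolding two_torsion_cubic_def c\<^sub>4_def c6_def
  by (simp add: algebra_simps power2_eq_square power3_eq_cube)

text \<open>Since \<open>c\<^sub>6\<^sup>2 = c\<^sub>4\<^sup>3 (1 - 1728/j)\<close> and \<open>1728/j\<close> is divisible by 128, we have \<open>c\<^sub>4 = t\<^sup>2\<close>, \<open>c\<^sub>6 = t\<^sup>3 s\<close>
  with \<open>s\<close> congruent to 1 modulo 64. Rescaling by \<open>t\<close> turns the cubic into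
  \<open>Z\<^sup>3 - 27 Z - 54 s\<close>, which is close to \<open>(Z - 6) (Z + 3)\<^sup>2\<close> and has a root near 6.\<close>

lemma two_torsion_cubic_root:
  fixes E :: "two_adic weierstrass"
  assumes "elliptic_curve E" "v2 (j_invariant E) < 0"
  obtains x where "two_torsion_cubic E x = 0"
proof -
  define j where "j = j_invariant E"
  define C where "C = c\<^sub>4 E"
  define D where "D = discriminant E"
  have j: "j = C ^ 3 / D" "D \<noteq> 0"
    using assms(1) by (simp_all add: j_def C_def D_def j_invariant_def elliptic_curve_def)
  have j0: "j \<noteq> 0" using assms(2) by (auto simp: j_def)
  hence C0: "C \<noteq> 0" using j by auto
  obtain k u where ku: "j = 2 powi k * to_fract u" "u dvd 1" using j0 by (rule two_adic_decomp)
  have "k < 0" using assms(2) v2_decomp[OF ku(2), of k] by (simp add: j_def[symmetric] ku(1))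
  then obtain n where n: "k = - int (Suc n)" by (metis negD)
  obtain u' where u': "inverse (to_fract u) = to_fract u'" using ku(2) by (rule unit_inverse)
  define m where "m = 2 ^ n * u'"
  have "inverse (2 powi k) = (2 ^ Suc n :: two_adic)"
    by (simp add: n power_int_minus del: of_nat_Suc power_Suc)
  \<comment> \<open>Negativity of the value of j gives one factor 2, which together with 1728 = 64 *
    27 makes 128.\<close>
  hence jm: "inverse j = 2 * to_fract m"
    unfolding ku(1) inverse_mult_distrib u' by (simp add: m_def)
  obtain z where z: "1 + 128 * (- 27 * m) = (1 + 64 * z)\<^sup>2" using square_of_one_mod_128 by blast
  define s where "s = to_fract (1 + 64 * z)"
  have s2: "s\<^sup>2 = 1 - 1728 * inverse j"
  proof -
    have "s\<^sup>2 = to_fract (1 + 128 * (- 27 * m))" unfolding z s_def by simp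
    thus ?thesis unfolding jm by simp
  qed
  have "1 + 64 * z = 1 + 2 * (32 * z)" by simp
  hence "v2 s = 0" unfolding s_def using v2_odd[of "32 * z"] by metis
  hence s0: "s \<noteq> 0" by auto
  have c6: "c6 E ^ 2 = C ^ 3 * s\<^sup>2"
  proof -
    have "c6 E ^ 2 = C ^ 3 - 1728 * D" using c4_c6_discriminant[of E] by (simp add: C_def D_def)
    thus ?thesis using C0 j(2) unfolding s2 j(1) by (simp add: algebra_simps)
  qed
  \<comment> \<open>Of the two square roots of C, this one has the sign for which
    \<open>t ^ 3 * s\<close> is \<open>c6 E\<close> and not its negative.\<close>
  define t where "t = c6 E / (C * s)"
  have "t\<^sup>2 = C"
    unfolding t_def power_divide power_mult_distrib c6 using C0 s0
    by (simp add: power2_eq_square power3_eq_cube)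
  moreover have "t ^ 3 * s = t\<^sup>2 * (t * s)" by (simp add: power2_eq_square power3_eq_cube)
  moreover have "C * (t * s) = c6 E" using C0 s0 by (simp add: t_def)
  ultimately have t: "C = t\<^sup>2" "c6 E = t ^ 3 * s" by simp_all
  obtain w where w: "w = - (- 1728 * z + 80 * w + 36 * w\<^sup>2 + 4 * w ^ 3)" using cubic_fixpoint by blast
  hence w': "4 * w ^ 3 + 36 * w\<^sup>2 + 81 * w = 1728 * z" by (simp add: algebra_simps)
  define Z where "Z = to_fract (6 + 2 * w)"
  have "(6 + 2 * w) ^ 3 - 27 * (6 + 2 * w) - 54 * (1 + 64 * z) =
      2 * (4 * w ^ 3 + 36 * w\<^sup>2 + 81 * w) - 3456 * z"
    by (simp add: algebra_simps power2_eq_square power3_eq_cube)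
  also have "\<dots> = 0" unfolding w' by simp
  finally have "to_fract ((6 + 2 * w) ^ 3 - 27 * (6 + 2 * w) - 54 * (1 + 64 * z)) = 0"
    by (simp only: to_fract_0)
  hence Z: "Z ^ 3 - 27 * Z - 54 * s = 0"
    unfolding Z_def s_def by (simp only: to_fract_diff to_fract_mult to_fract_power to_fract_numeral)
  define x where "x = (t * Z - 3 * b\<^sub>2 E) / 36"
  have x: "36 * x + 3 * b\<^sub>2 E = t * Z" by (simp add: x_def diff_divide_distrib)
  have "11664 * two_torsion_cubic E x = (t * Z) ^ 3 - 27 * t\<^sup>2 * (t * Z) - 54 * (t ^ 3 * s)"
    unfolding two_torsion_cubic_depressed x t(2) C_def[symmetric] t(1) by (simp add: mult_ac)
  also have "\<dots> = t ^ 3 * (Z ^ 3 - 27 * Z - 54 * s)"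
    by (simp add: algebra_simps power2_eq_square power3_eq_cube)
  finally have "two_torsion_cubic E x = 0" unfolding Z by simp
  thus ?thesis by (rule that)
qed

section \<open>The 2-torsion points and the field they generate\<close>

text \<open>A point is killed by 2 iff it equals its negative, which for an affine point determines
  y from x. Completing the square in y then turns the equation of the curve into the vanishing of
  the cubic.\<close>

lemma two_torsion_points:
  fixes E :: "'a :: field_char_0 weierstrass"
  shows "ec_torsion E 2 = insert Infinity
    {Affine x (- (a\<^sub>1 E * x + a\<^sub>3 E) / 2) | x. two_torsion_cubic E x = 0}"
proof -
  have add: "ec_add E (Affine x y) (Affine x y) = Infinity \<longleftrightarrow> y = - (a\<^sub>1 E * x + a\<^sub>3 E) / 2" for x y
  proof -
    have "y + y + a\<^sub>1 E * x + a\<^sub>3 E = 0 \<longleftrightarrow> 2 * y = - (a\<^sub>1 E * x + a\<^sub>3 E)"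
      unfolding eq_neg_iff_add_eq_0 by (simp add: add.assoc)
    also have "\<dots> \<longleftrightarrow> y = - (a\<^sub>1 E * x + a\<^sub>3 E) / 2" by (auto simp: eq_divide_eq mult.commute)
    finally show ?thesis by (simp add: Let_def)
  qed
  have tors: "(ec_add E P ^^ 2) Infinity = ec_add E P P" for P
    by (cases P) (simp_all add: numeral_2_eq_2 del: ec_add.simps(3))
  have curve: "y\<^sup>2 + a\<^sub>1 E * x * y + a\<^sub>3 E * y = x ^ 3 + a\<^sub>2 E * x\<^sup>2 + a\<^sub>4 E * x + a\<^sub>6 E
      \<longleftrightarrow> two_torsion_cubic E x = 0" if y: "y = - (a\<^sub>1 E * x + a\<^sub>3 E) / 2" for x y
  proof -
    define d where "d = y\<^sup>2 + a\<^sub>1 E * x * y + a\<^sub>3 E * y - (x ^ 3 + a\<^sub>2 E * x\<^sup>2 + a\<^sub>4 E * x + a\<^sub>6 E)"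
    have "2 * y = - (a\<^sub>1 E * x + a\<^sub>3 E)" by (simp add: y)
    hence zero: "2 * y + a\<^sub>1 E * x + a\<^sub>3 E = 0" by simp
    have "4 * d = (2 * y + a\<^sub>1 E * x + a\<^sub>3 E)\<^sup>2 - two_torsion_cubic E x"
      unfolding d_def two_torsion_cubic_def b\<^sub>2_def b\<^sub>4_def b\<^sub>6_def
      by (simp add: algebra_simps power2_eq_square)
    hence "4 * d = - two_torsion_cubic E x" unfolding zero by simp
    hence "d = 0 \<longleftrightarrow> two_torsion_cubic E x = 0"
      by (metis mult_eq_0_iff neg_equal_0_iff_equal zero_neq_numeral)
    thus ?thesis by (simp add: d_def)
  qed
  show ?thesis
  proof (intro equalityI subsetI)
    fix P assume P: "P \<in> ec_torsion E 2"
    show "P \<in> insert Infinity {Affine x (- (a\<^sub>1 E * x + a\<^sub>3 E) / 2) | x. two_torsion_cubic E x = 0}"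
    proof (cases P)
      case (Affine x y)
      hence y: "y = - (a\<^sub>1 E * x + a\<^sub>3 E) / 2"
        using P add[of x y] by (simp only: ec_torsion_def tors mem_Collect_eq)
      have "Affine x y \<in> ec_points E" using P Affine by (simp add: ec_torsion_def)
      hence "y\<^sup>2 + a\<^sub>1 E * x * y + a\<^sub>3 E * y = x ^ 3 + a\<^sub>2 E * x\<^sup>2 + a\<^sub>4 E * x + a\<^sub>6 E"
        by (simp add: ec_points_def)
      hence "two_torsion_cubic E x = 0" using curve[OF y] by blast
      thus ?thesis using Affine y by blast
    qed simp
  next
    fix P assume "P \<in> insert Infinity {Affine x (- (a\<^sub>1 E * x + a\<^sub>3 E) / 2) | x. two_torsion_cubic E x = 0}"
    then consider "P = Infinity" | x where "P = Affine x (- (a\<^sub>1 E * x + a\<^sub>3 E) / 2)" "two_torsion_cubic E x = 0"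
      by blast
    thus "P \<in> ec_torsion E 2"
    proof cases
      case 1
      thus ?thesis by (simp add: ec_torsion_def tors ec_points_def)
    next
      case 2
      define y where "y = - (a\<^sub>1 E * x + a\<^sub>3 E) / 2"
      have "Affine x y \<in> ec_points E"
        using curve[OF y_def] 2(2) by (simp add: ec_points_def)
      moreover have "ec_add E (Affine x y) (Affine x y) = Infinity" using add y_def by blast
      ultimately show ?thesis
        unfolding 2(1) y_def[symmetric] ec_torsion_def tors by blast
    qed
  qed
qed

lemma weierstrass_map_to_ac:
  "a\<^sub>1 (map_weierstrass to_ac E) = to_ac (a\<^sub>1 E)"
  "a\<^sub>3 (map_weierstrass to_ac E) = to_ac (a\<^sub>3 E)"
  "b\<^sub>2 (map_weierstrass to_ac E) = to_ac (b\<^sub>2 E)"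
  "b\<^sub>4 (map_weierstrass to_ac E) = to_ac (b\<^sub>4 E)"
  "b\<^sub>6 (map_weierstrass to_ac E) = to_ac (b\<^sub>6 E)"
  by (cases E; simp add: b\<^sub>2_def b\<^sub>4_def b\<^sub>6_def)+

text \<open>Splitting off r leaves a monic quadratic; x is the square root p + 2 x1 of its
  discriminant. The second root is -p - x1 and the y-coordinates are affine in the x-coordinates, so
  x1 alone generates the field.\<close>

lemma torsion_field_2_eq:
  fixes E :: "two_adic weierstrass"
  assumes root: "two_torsion_cubic E r = 0"
  obtains x d where "x\<^sup>2 = to_ac d" "torsion_field E 2 = adjoin_Q2 {x}"
proof -
  define E' where "E' = map_weierstrass to_ac E"
  \<comment> \<open>p and q are the coefficients of the quotient of the cubic by 4 (X - r). That the
    constant terms match is the assumption that r is a root.\<close>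
  define p where "p = r + b\<^sub>2 E / 4"
  define q where "q = r * p + b\<^sub>4 E / 2"
  have factor: "two_torsion_cubic E' x = 4 * (x - to_ac r) * (x\<^sup>2 + to_ac p * x + to_ac q)" for x
  proof -
    have p: "b\<^sub>2 E = 4 * (p - r)" by (simp add: p_def)
    have q: "2 * b\<^sub>4 E = 4 * (q - r * p)" by (simp add: q_def)
    have "b\<^sub>6 E = - (4 * r ^ 3 + b\<^sub>2 E * r\<^sup>2 + 2 * b\<^sub>4 E * r)"
      using root unfolding two_torsion_cubic_def by (simp only: eq_neg_iff_add_eq_0 add.commute)
    also have "\<dots> = - 4 * r * q"
      unfolding p q by (simp add: algebra_simps power2_eq_square power3_eq_cube)
    finally have b6: "b\<^sub>6 E = - 4 * r * q" .
    have "two_torsion_cubic E' x =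
        4 * x ^ 3 + to_ac (b\<^sub>2 E) * x\<^sup>2 + to_ac (2 * b\<^sub>4 E) * x + to_ac (b\<^sub>6 E)"
      by (simp add: two_torsion_cubic_def E'_def weierstrass_map_to_ac)
    thus ?thesis
      unfolding p q b6 by (simp add: algebra_simps power2_eq_square power3_eq_cube)
  qed
  obtain x1 where x1: "x1\<^sup>2 + to_ac p * x1 + to_ac q = 0" using quadratic_root_exists by blast
  have roots: "x = to_ac r \<or> x = x1 \<or> x = - to_ac p - x1" if "two_torsion_cubic E' x = 0" for x
  proof (cases "x = to_ac r")
    case False
    hence x: "x\<^sup>2 + to_ac p * x + to_ac q = 0" using that by (simp add: factor)
    have "(x - x1) * (x - (- to_ac p - x1)) =
        (x\<^sup>2 + to_ac p * x + to_ac q) - (x1\<^sup>2 + to_ac p * x1 + to_ac q)"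
      by (simp add: algebra_simps power2_eq_square)
    hence "(x - x1) * (x - (- to_ac p - x1)) = 0" unfolding x x1 by simp
    thus ?thesis by auto
  qed simp
  define T where "T = (\<Union>P\<in>ec_torsion E' 2. set_ec_point P)"
  have T: "T = (\<Union>x\<in>{x. two_torsion_cubic E' x = 0}. {x, - (a\<^sub>1 E' * x + a\<^sub>3 E') / 2})"
    unfolding T_def two_torsion_points by auto
  have "adjoin_Q2 T = adjoin_Q2 {x1}"
  proof (rule adjoin_Q2_eqI)
    show "{x1} \<subseteq> adjoin_Q2 T" using adjoin_Q2_incl[of T] x1 by (auto simp: T factor)
    note D = subfield_closure_ringD[OF subfield_adjoin_Q2[of "{x1}"]]
    have ac: "to_ac y \<in> adjoin_Q2 {x1}" for y using adjoin_Q2_incl[of "{x1}"] by auto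
    have mem1: "x1 \<in> adjoin_Q2 {x1}" using adjoin_Q2_incl[of "{x1}"] by auto
    have "- to_ac p - x1 = - (to_ac p + x1)" by simp
    hence mem2: "- to_ac p - x1 \<in> adjoin_Q2 {x1}" using D(3)[OF ac mem1] D(4) by metis
    have x: "x \<in> adjoin_Q2 {x1}" if "two_torsion_cubic E' x = 0" for x
      using roots[OF that] mem1 mem2 ac by metis
    have y: "- (a\<^sub>1 E' * x + a\<^sub>3 E') / 2 \<in> adjoin_Q2 {x1}" if "two_torsion_cubic E' x = 0" for x
    proof -
      have "- (a\<^sub>1 E' * x + a\<^sub>3 E') / 2 = to_ac (- a\<^sub>1 E / 2) * x + to_ac (- a\<^sub>3 E / 2)"
        by (simp add: E'_def weierstrass_map_to_ac add_divide_distrib)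
      also have "\<dots> \<in> adjoin_Q2 {x1}" by (intro D(3) D(5) ac x that)
      finally show ?thesis .
    qed
    show "T \<subseteq> adjoin_Q2 {x1}" unfolding T using x y by blast
  qed
  also have "adjoin_Q2 {x1} = adjoin_Q2 {to_ac p + to_ac 2 * x1}"
    by (rule adjoin_Q2_affine[symmetric]) simp
  finally have "torsion_field E 2 = adjoin_Q2 {to_ac p + to_ac 2 * x1}"
    by (simp add: torsion_field_def T_def E'_def)
  moreover have "(to_ac p + to_ac 2 * x1)\<^sup>2 = to_ac (p\<^sup>2 - 4 * q)"
  proof -
    have "(to_ac p + to_ac 2 * x1)\<^sup>2 = 4 * (x1\<^sup>2 + to_ac p * x1 + to_ac q) + to_ac (p\<^sup>2 - 4 * q)"
      by (simp add: algebra_simps power2_eq_square)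
    thus ?thesis unfolding x1 by simp
  qed
  ultimately show ?thesis using that by blast
qed

theorem theorem2p16:
  fixes E :: "two_adic weierstrass" and L :: "two_adic_closure set"
  assumes "elliptic_curve E"
    and "v2 (j_invariant E) < 0"
    and "L = torsion_field E 2"
  shows "L = Q2 \<or>
         (L = Q4 \<and> max_upper_break L Q2 = 0) \<or>
         (\<exists>i\<in>{1..6}. L = ramified_quadratic i \<and> max_upper_break L Q2 \<in> {2, 3})"
proof -
  obtain r where r: "two_torsion_cubic E r = 0"
    using assms(1,2) by (rule two_torsion_cubic_root)
  obtain x d where x: "x\<^sup>2 = to_ac d" "torsion_field E 2 = adjoin_Q2 {x}"
    using r by (rule torsion_field_2_eq)
  have "L = Q2 \<or> L = quad omega \<or> (\<exists>i\<in>{1..6}. L = ramified_quadratic i)"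
    using adjoin_sqrt_cases[OF x(1)] assms(3) x(2) by simp
  thus ?thesis
    using Q4_eq max_upper_break_omega ramified_quadratic_properties(2) by metis
qed

end
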